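(* Let $K$ be an algebraically closed field, $S=K[y_0,\dots,y_n]$, $\mathfrak M=(y_0,\dots,y_n)$. Let $\mathfrak H=(g_1,\dots,g_r)$ be a homogeneous ideal of $S$ such that $\mathfrak H^{sat}\subsetneq \mathfrak M$, let $f$ be any form in $\mathfrak M$, and let $\mathfrak I=(\mathfrak H,f)$. The following are equivalent: (i) there exists $t\in\mathbb N$ such that $f\,\mathfrak M^t\subseteq \mathfrak H$ (in other words, $f\in\mathfrak H^{sat}$); (ii) $S/\mathfrak I$ and $S/\mathfrak H$ have the same Hilbert polynomial; (iii) there exists a linear form $z\in S$, regular for $S/\mathfrak H^{sat}$, such that dehomogenization with respect to $z$ gives $\mathfrak H_*=\mathfrak I_*$; (iv) $\mathfrak H_*=\mathfrak I_*$ for the dehomogenization with respect to any linear form $z\in\mathfrak M$.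
   Context: For a homogeneous ideal $\mathfrak I\subseteq S$, $\mathfrak I^{sat}=\{f\in S:\ f\,\mathfrak M^t\subseteq\mathfrak I\text{ for some }t\in\mathbb N\}$. A form $z$ is regular for $S/\mathfrak J$ if it is a nonzerodivisor on $S/\mathfrak J$. Dehomogenization with respect to a (nonzero) linear form $L$: after a linear change of coordinates with $L=y_0$, a form $F(y_0,\dots,y_n)$ is sent to the polynomial $F_*(x_1,\dots,x_n)=F(1,x_1,\dots,x_n)\in R=K[x_1,\dots,x_n]$, and $\mathfrak I_*\subseteq R$ is the ideal which is the image of $\mathfrak I$ under this map (equivalently, the image of $\mathfrak I$ in $S/(L-1)S$). *)

theory Defs
  imports
    "HOL-Library.Poly_Mapping"
    "HOL-Computational_Algebra.Polynomial"
    "HOL-Analysis.Cartesian_Space"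
begin

text \<open>
  The ring \<open>S = K[y\<^sub>0, \<dots>, y\<^sub>n]\<close> is the whole type \<open>('v, 'k) mpoly\<close>, where the finite
  type \<open>'v\<close> indexes the variables; thus \<open>n + 1 = CARD('v)\<close>. A monomial is its exponent vector
  and a polynomial is the finitely supported family of its coefficients; multiplication is the
  convolution product of the library.
\<close>

type_synonym ('v, 'k) mpoly = "('v \<Rightarrow>\<^sub>0 nat) \<Rightarrow>\<^sub>0 'k"

text \<open>
  Ideals of a commutative ring are its submodules over itself: \<open>ideal.span G\<close> is the ideal
  generated by \<open>G\<close> and \<open>ideal.subspace\<close> is the predicate of being an ideal.
\<close>

interpretation ideal: module "(*) :: 'a::comm_ring_1 \<Rightarrow> 'a \<Rightarrow> 'a"
  by unfold_locales (simp_all add: algebra_simps)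

primrec ideal_power :: "'a::comm_ring_1 set \<Rightarrow> nat \<Rightarrow> 'a set" where
  "ideal_power A 0 = UNIV"
| "ideal_power A (Suc t) = ideal.span {a * b | a b. a \<in> A \<and> b \<in> ideal_power A t}"

definition Const :: "'k \<Rightarrow> ('v, 'k::comm_ring_1) mpoly" where
  "Const c = Poly_Mapping.single 0 c"

definition Var :: "'v \<Rightarrow> ('v, 'k::comm_ring_1) mpoly" where
  "Var v = Poly_Mapping.single (Poly_Mapping.single v 1) 1"

definition mon_degree :: "('v::finite \<Rightarrow>\<^sub>0 nat) \<Rightarrow> nat" where
  "mon_degree m = (\<Sum>v\<in>UNIV. Poly_Mapping.lookup m v)"

text \<open>As usual, the zero polynomial is a form of every degree.\<close>

definition homogeneous :: "nat \<Rightarrow> ('v::finite, 'k::comm_ring_1) mpoly \<Rightarrow> bool" where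
  "homogeneous d p \<longleftrightarrow> (\<forall>m\<in>Poly_Mapping.keys p. mon_degree m = d)"

definition is_form :: "('v::finite, 'k::comm_ring_1) mpoly \<Rightarrow> bool" where
  "is_form p \<longleftrightarrow> (\<exists>d. homogeneous d p)"

abbreviation linear_form :: "('v::finite, 'k::comm_ring_1) mpoly \<Rightarrow> bool" where
  "linear_form \<equiv> homogeneous 1"

definition homogeneous_ideal :: "('v::finite, 'k::comm_ring_1) mpoly set \<Rightarrow> bool" where
  "homogeneous_ideal J \<longleftrightarrow> (\<exists>F. (\<forall>p\<in>F. is_form p) \<and> J = ideal.span F)"

definition irrelevant_ideal :: "('v::finite, 'k::comm_ring_1) mpoly set" where
  "irrelevant_ideal = ideal.span (Var ` UNIV)"

definition saturation :: "('v::finite, 'k::comm_ring_1) mpoly set \<Rightarrow> ('v, 'k) mpoly set" where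
  "saturation J = {f. \<exists>t. (\<lambda>p. f * p) ` ideal_power irrelevant_ideal t \<subseteq> J}"

definition regular_mod :: "'a::comm_ring_1 \<Rightarrow> 'a set \<Rightarrow> bool" where
  "regular_mod z J \<longleftrightarrow> (\<forall>p. z * p \<in> J \<longrightarrow> p \<in> J)"

text \<open>
  \<open>B\<close> represents a \<open>K\<close>-basis of the degree \<open>d\<close> component of \<open>S/J\<close>, the image of \<open>S\<^sub>d\<close>:
  its members are forms of degree \<open>d\<close> whose residue classes modulo \<open>J\<close> are linearly
  independent and span that component.
\<close>

definition graded_quotient_basis ::
    "('v::finite, 'k::field) mpoly set \<Rightarrow> nat \<Rightarrow> ('v, 'k) mpoly set \<Rightarrow> bool" where
  "graded_quotient_basis J d B \<longleftrightarrow>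
     finite B \<and> B \<subseteq> {p. homogeneous d p} \<and>
     (\<forall>c. (\<Sum>b\<in>B. Const (c b) * b) \<in> J \<longrightarrow> (\<forall>b\<in>B. c b = 0)) \<and>
     (\<forall>p. homogeneous d p \<longrightarrow> (\<exists>c. p - (\<Sum>b\<in>B. Const (c b) * b) \<in> J))"

definition hilbert_function :: "('v::finite, 'k::field) mpoly set \<Rightarrow> nat \<Rightarrow> nat" where
  "hilbert_function J d = (THE m. \<exists>B. graded_quotient_basis J d B \<and> card B = m)"

definition hilbert_polynomial :: "('v::finite, 'k::field) mpoly set \<Rightarrow> rat poly" where
  "hilbert_polynomial J =
     (THE P. \<forall>\<^sub>F d in sequentially. of_nat (hilbert_function J d) = poly P (of_nat d))"

text \<open>The \<open>K\<close>-algebra homomorphism with \<open>Var v \<mapsto> \<sigma> v\<close>.\<close>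

definition subst_vars ::
    "('v \<Rightarrow> ('v, 'k) mpoly) \<Rightarrow> ('v::finite, 'k::comm_ring_1) mpoly \<Rightarrow> ('v, 'k) mpoly" where
  "subst_vars \<sigma> p =
     (\<Sum>m\<in>Poly_Mapping.keys p.
        Const (Poly_Mapping.lookup p m) * (\<Prod>v\<in>UNIV. \<sigma> v ^ Poly_Mapping.lookup m v))"

text \<open>
  The linear substitution \<open>y\<^sub>v \<mapsto> \<Sum>\<^sub>w A\<^sub>v\<^sub>w y\<^sub>w\<close>, which rewrites a polynomial in new
  coordinates. For invertible \<open>A\<close> it is a coordinate change; it is adapted to the linear form \<open>L\<close>
  if \<open>L\<close> becomes the variable \<open>v0\<close>, which plays the role of \<open>y\<^sub>0\<close>.
\<close>

definition linear_change ::
    "'k ^ 'v ^ 'v \<Rightarrow> ('v::finite, 'k::comm_ring_1) mpoly \<Rightarrow> ('v, 'k) mpoly" where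
  "linear_change A = subst_vars (\<lambda>v. \<Sum>w\<in>UNIV. Const (A $ v $ w) * Var w)"

definition adapted_coords ::
    "'v \<Rightarrow> ('v::finite, 'k::comm_ring_1) mpoly \<Rightarrow> 'k ^ 'v ^ 'v \<Rightarrow> bool" where
  "adapted_coords v0 L A \<longleftrightarrow> invertible A \<and> linear_change A L = Var v0"

text \<open>
  Dehomogenization in the coordinates given by \<open>A\<close>: the new variable \<open>v0\<close> is set to \<open>1\<close>. The ring
  \<open>R = K[x\<^sub>1, \<dots>, x\<^sub>n]\<close> is the subring of the polynomials that do not involve \<open>v0\<close>.
\<close>

definition dehom ::
    "'v \<Rightarrow> 'k ^ 'v ^ 'v \<Rightarrow> ('v::finite, 'k::comm_ring_1) mpoly \<Rightarrow> ('v, 'k) mpoly" where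
  "dehom v0 A p = subst_vars (\<lambda>v. if v = v0 then 1 else Var v) (linear_change A p)"

end

theory Submission
  imports Defs
begin

text \<open>
  Each of the four conditions is equivalent to \<open>f \<in> saturation H\<close>, and condition (i) is just the
  definition of this membership. The saturation has a description that is easier to handle: \<open>f\<close>
  belongs to it iff for every variable \<open>y\<^sub>v\<close> some power \<open>y\<^sub>v\<^sup>k f\<close> lies in \<open>H\<close>, because a
  monomial of large degree is divisible by a large power of some variable (\<open>saturation_iff\<close>).

  Hilbert polynomials. If \<open>f\<close> is in the saturation, then \<open>I\<close> and \<open>H\<close> agree in all large degrees
  (\<open>eventually_eq_if_mem_saturation\<close>), so their Hilbert polynomials agree. For the converse one needs
  that Hilbert functions really are polynomial in large degrees. By a Groebner basis argument the
  Hilbert function of \<open>S/J\<close> counts the monomials outside the set of leading monomials of \<open>J\<close>, which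
  is closed under multiplication by monomials
  (\<open>graded_quotient_basis_standard_monomials\<close>). That such a count is eventually polynomial follows by
  Noetherian induction on the set \<open>U\<close> of leading monomials: for a variable \<open>y\<close> outside \<open>U\<close>, splitting
  the monomials outside \<open>U\<close> into those divisible by \<open>y\<close> and the others expresses the count for \<open>U\<close> by
  the counts for \<open>U : y\<close> and for \<open>U + (y)\<close>. The second set is larger than \<open>U\<close>, and so is the first
  unless \<open>U : y = U\<close>; in that case the difference of two consecutive values is eventually a polynomial
  (\<open>card_standard_monomials_eventually_poly\<close>). Once \<open>I\<close> and \<open>H\<close> have the same Hilbert
  polynomial, in each large degree the basis of standard monomials is the same for both, hence they agree
  there, and \<open>y\<^sub>v\<^sup>k f \<in> H\<close> for large \<open>k\<close>.

  Dehomogenization. If \<open>z\<close> is a nonzero linear form, then \<open>f\<^sub>* \<in> H\<^sub>*\<close> iff \<open>z\<^sup>k f \<in> H\<close> for some \<open>k\<close>: a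
  relation between dehomogenized polynomials can be made homogeneous again by powers of \<open>z\<close>
  (\<open>dehom_mem_imp_power_mult_mem\<close>). If \<open>f\<close> is in the saturation, then for every linear form \<open>z\<close>
  some \<open>z\<^sup>k f\<close> lies in \<open>H\<close>. Conversely, applied to all variables, condition (iv) gives the
  description of the saturation above; and if \<open>z\<close> is regular modulo the saturation, then \<open>z\<^sup>k f \<in> H\<close> alone forces \<open>f\<close> into it.

  The existence of a regular linear form, which (iii) asserts, comes from an irreducible decomposition of
  \<open>saturation H\<close>. The zero divisors modulo a proper irreducible ideal form an ideal, whose elements
  are nilpotent modulo it. Components for which it contains all variables can be dropped, because
  \<open>saturation H\<close> is saturated. For each of the others the linear forms that are zero divisors make up a
  proper subspace, and over an infinite field finitely many of these do not cover all linear forms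
  (\<open>regular_linear_form_exists\<close>).

  Both arguments by Noetherian induction rest on Dickson's lemma: it yields the ascending chain condition for
  sets of monomials closed under multiplication (\<open>wf_upsets\<close>), and division with remainder carries it
  over to all ideals (\<open>noetherian_mpoly\<close>).
\<close>

abbreviation lookup where "lookup \<equiv> Poly_Mapping.lookup"
abbreviation keys where "keys \<equiv> Poly_Mapping.keys"
abbreviation single where "single \<equiv> Poly_Mapping.single"

text \<open>
  The rule \<open>ideal.scale_scale\<close> reassociates products to the left and \<open>ac_simps\<close> to the right, so
  rewriting with both does not terminate.
\<close>

declare ideal.scale_scale [simp del]

section \<open>Monomials, substitutions and homogeneous components\<close>

lemma sum_of_monomials: "p = (\<Sum>m\<in>keys p. single m (lookup p m))"
  by (rule poly_mapping_eqI)
    (auto simp: lookup_sum lookup_single when_def in_keys_iff sum.delta')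

lemma mpoly_additive_induct [case_names single add]:
  fixes p :: "('v, 'k::comm_ring_1) mpoly"
  assumes single: "\<And>m c. P (single m c)" and add: "\<And>p q. P p \<Longrightarrow> P q \<Longrightarrow> P (p + q)"
  shows "P p"
proof -
  have "P (\<Sum>m\<in>A. single m (lookup p m))" if "finite A" for A
    using that
  proof (induction A)
    case empty
    have "P (single 0 0)" by (rule single)
    then show ?case by simp
  next
    case (insert m A)
    then show ?case by (simp add: single add)
  qed
  from this[of "keys p"] show ?thesis
    by (simp flip: sum_of_monomials)
qed

lemma lookup_single_mult:
  fixes p :: "('v, 'k::comm_ring_1) mpoly"
  shows "lookup (single a c * p) (a + m) = c * lookup p m"
  by (induction p rule: mpoly_additive_induct)
    (auto simp: mult_single lookup_single when_def lookup_add distrib_left)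

lemma Const_0: "Const 0 = 0" and Const_1: "Const 1 = 1"
  and Const_add: "Const (c + d) = Const c + Const d"
  and Const_mult: "Const (c * d) = Const c * Const d"
  and Const_uminus: "Const (- c) = - Const c"
  by (simp_all add: Const_def single_add mult_single single_uminus)

lemma Const_sum: "Const (\<Sum>i\<in>A. f i) = (\<Sum>i\<in>A. Const (f i))"
  by (induction A rule: infinite_finite_induct) (auto simp: Const_0 Const_add)

lemma lookup_Const_mult: "lookup (Const c * p) m = c * lookup p m"
  using lookup_single_mult[of 0 c p m] by (simp add: Const_def)

lemma keys_Const_mult: "keys (Const c * p) \<subseteq> keys p"
  by (auto simp: in_keys_iff lookup_Const_mult)

lemma Var_power: "Var v ^ k = (single (single v k) 1 :: ('v, 'k::comm_ring_1) mpoly)"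
  proof (induction k)
  case (Suc k)
  have "single v (1::nat) + single v k = single v (Suc k)"
    by (simp flip: single_add)
  with Suc show ?case
    by (simp add: Var_def mult_single)
qed simp

lemma monomial_eq_prod:
  fixes m :: "'v::finite \<Rightarrow>\<^sub>0 nat"
  shows "single m (1::'k::comm_ring_1) = (\<Prod>v\<in>UNIV. Var v ^ lookup m v)"
proof -
  have "(\<Prod>v\<in>A. Var v ^ lookup m v) = single (\<Sum>v\<in>A. single v (lookup m v)) (1::'k)" if "finite A" for A
    using that by (induction A) (auto simp: Var_power mult_single simp flip: single_one)
  moreover have "(\<Sum>v\<in>UNIV. single v (lookup m v)) = m"
    by (rule poly_mapping_eqI) (auto simp: lookup_sum lookup_single when_def)
  ultimately show ?thesis
    by simp
qed

lemma single_eq_Const_mult: "single m c = Const c * single m (1::'k::comm_ring_1)"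
  by (simp add: Const_def mult_single)

lemma subst_vars_superset:
  assumes "finite A" "keys p \<subseteq> A"
  shows "subst_vars \<sigma> p = (\<Sum>m\<in>A. Const (lookup p m) * (\<Prod>v\<in>UNIV. \<sigma> v ^ lookup m v))"
  unfolding subst_vars_def
  by (rule sum.mono_neutral_left) (use assms in \<open>auto simp: in_keys_iff Const_0\<close>)

lemma subst_vars_single: "subst_vars \<sigma> (single m c) = Const c * (\<Prod>v\<in>UNIV. \<sigma> v ^ lookup m v)"
  by (subst subst_vars_superset[of "{m}"]) (auto simp: lookup_single when_def)

lemma subst_vars_add: "subst_vars \<sigma> (p + q) = subst_vars \<sigma> p + subst_vars \<sigma> q"
proof -
  let ?A = "keys p \<union> keys q"
  have "keys (p + q) \<subseteq> ?A" by (rule Poly_Mapping.keys_add)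
  then show ?thesis
    by (simp add: subst_vars_superset[of ?A] lookup_add Const_add distrib_right sum.distrib)
qed

lemma subst_vars_mult: "subst_vars \<sigma> (p * q) = subst_vars \<sigma> p * subst_vars \<sigma> q"
proof (induction p rule: mpoly_additive_induct)
  case (single m c)
  show ?case
    by (induction q rule: mpoly_additive_induct)
      (simp_all add: mult_single subst_vars_single subst_vars_add lookup_add power_add
        prod.distrib Const_mult distrib_left)
qed (simp_all add: distrib_right subst_vars_add)

lemma subst_vars_Const: "subst_vars \<sigma> (Const c) = Const c"
  unfolding Const_def by (subst subst_vars_single) (simp add: Const_def)

lemma subst_vars_Var: "subst_vars \<sigma> (Var v) = \<sigma> v"
proof -
  have "(\<Prod>u\<in>UNIV. \<sigma> u ^ lookup (single v 1) u) = (\<Prod>u\<in>UNIV. if u = v then \<sigma> u else 1)"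
    by (rule prod.cong) (auto simp: lookup_single)
  then show ?thesis
    by (simp add: Var_def subst_vars_single Const_1)
qed

lemma subst_vars_0: "subst_vars \<sigma> 0 = 0"
  by (simp add: subst_vars_def)

lemma subst_vars_1: "subst_vars \<sigma> 1 = 1"
  using subst_vars_Const[of \<sigma> 1] by (simp add: Const_1)

lemma subst_vars_sum: "subst_vars \<sigma> (\<Sum>i\<in>A. p i) = (\<Sum>i\<in>A. subst_vars \<sigma> (p i))"
  by (induction A rule: infinite_finite_induct) (auto simp: subst_vars_0 subst_vars_add)

lemma subst_vars_power: "subst_vars \<sigma> (p ^ k) = subst_vars \<sigma> p ^ k"
  by (induction k) (auto simp: subst_vars_1 subst_vars_mult)

lemma subst_vars_prod: "subst_vars \<sigma> (\<Prod>i\<in>A. p i) = (\<Prod>i\<in>A. subst_vars \<sigma> (p i))"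
  by (induction A rule: infinite_finite_induct) (auto simp: subst_vars_1 subst_vars_mult)

lemma subst_vars_Var_id: "subst_vars Var p = p"
  by (induction p rule: mpoly_additive_induct)
    (simp_all add: subst_vars_add subst_vars_single flip: monomial_eq_prod single_eq_Const_mult)

lemma subst_vars_subst_vars: "subst_vars \<tau> (subst_vars \<sigma> p) = subst_vars (\<lambda>v. subst_vars \<tau> (\<sigma> v)) p"
  by (induction p rule: mpoly_additive_induct)
    (simp_all add: subst_vars_add subst_vars_single subst_vars_mult subst_vars_Const
      subst_vars_prod subst_vars_power)

lemma mon_degree_add: "mon_degree (a + b) = mon_degree a + mon_degree b"
  by (simp add: mon_degree_def lookup_add sum.distrib)

lemma mon_degree_single: "mon_degree (single v k) = k"
  by (simp add: mon_degree_def lookup_single when_def)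

lemma finite_mon_degree: "finite {m :: 'v::finite \<Rightarrow>\<^sub>0 nat. mon_degree m = d}"
proof (rule finite_imageD)
  show "inj_on lookup {m :: 'v \<Rightarrow>\<^sub>0 nat. mon_degree m = d}"
    by (simp add: inj_on_def lookup_inject)
  have "lookup m v \<le> mon_degree m" for m :: "'v \<Rightarrow>\<^sub>0 nat" and v
    unfolding mon_degree_def by (rule member_le_sum) auto
  then have "lookup ` {m :: 'v \<Rightarrow>\<^sub>0 nat. mon_degree m = d} \<subseteq> {f. \<forall>v. f v \<in> {..d}}"
    by auto
  moreover have "finite {f :: 'v \<Rightarrow> nat. \<forall>v. f v \<in> {..d}}"
    using finite_PiE[of "UNIV :: 'v set" "\<lambda>_. {..d}"] by (simp add: PiE_def Pi_def)
  ultimately show "finite (lookup ` {m :: 'v \<Rightarrow>\<^sub>0 nat. mon_degree m = d})"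
    by (rule finite_subset)
qed

lemma homogeneous_0: "homogeneous d 0"
  by (simp add: homogeneous_def)

lemma homogeneous_single: "mon_degree m = d \<Longrightarrow> homogeneous d (single m c)"
  by (simp add: homogeneous_def)

lemma homogeneous_Var: "homogeneous 1 (Var v)"
  by (simp add: Var_def homogeneous_single mon_degree_single)

lemma homogeneous_Const: "homogeneous 0 (Const c)"
  by (simp add: Const_def homogeneous_single mon_degree_def)

lemma homogeneous_1: "homogeneous 0 1"
  using homogeneous_Const[of 1] by (simp add: Const_1)

lemma homogeneous_add: "homogeneous d p \<Longrightarrow> homogeneous d q \<Longrightarrow> homogeneous d (p + q)"
  unfolding homogeneous_def using Poly_Mapping.keys_add[of p q] by blast

lemma homogeneous_diff: "homogeneous d p \<Longrightarrow> homogeneous d q \<Longrightarrow> homogeneous d (p - q)"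
  unfolding homogeneous_def using keys_diff[of p q] by blast

lemma homogeneous_sum: "(\<And>i. i \<in> A \<Longrightarrow> homogeneous d (p i)) \<Longrightarrow> homogeneous d (\<Sum>i\<in>A. p i)"
  by (induction A rule: infinite_finite_induct) (auto simp: homogeneous_0 homogeneous_add)

lemma homogeneous_mult: "homogeneous d p \<Longrightarrow> homogeneous e q \<Longrightarrow> homogeneous (d + e) (p * q)"
  unfolding homogeneous_def using keys_mult[of p q] by (fastforce simp: mon_degree_add)

lemma homogeneous_Const_mult: "homogeneous d p \<Longrightarrow> homogeneous d (Const c * p)"
  using homogeneous_mult[OF homogeneous_Const] by fastforce

lemma homogeneous_power: "homogeneous d p \<Longrightarrow> homogeneous (k * d) (p ^ k)"
  by (induction k) (auto simp: homogeneous_1 homogeneous_mult)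

lemma homogeneous_prod:
  "finite A \<Longrightarrow> (\<And>i. i \<in> A \<Longrightarrow> homogeneous (d i) (p i)) \<Longrightarrow> homogeneous (\<Sum>i\<in>A. d i) (\<Prod>i\<in>A. p i)"
  by (induction A rule: finite_induct) (auto simp: homogeneous_1 homogeneous_mult)

lift_definition hcomp :: "nat \<Rightarrow> ('v::finite, 'k::comm_ring_1) mpoly \<Rightarrow> ('v, 'k) mpoly"
  is "\<lambda>d p m. if mon_degree m = d then p m else 0"
  by (erule rev_finite_subset) auto

lemma keys_hcomp: "keys (hcomp d p) = {m \<in> keys p. mon_degree m = d}"
  by (auto simp: in_keys_iff hcomp.rep_eq split: if_splits)

lemma homogeneous_hcomp: "homogeneous d (hcomp d p)"
  by (simp add: homogeneous_def keys_hcomp)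

lemma hcomp_homogeneous: "homogeneous e p \<Longrightarrow> hcomp d p = (if d = e then p else 0)"
  by (rule poly_mapping_eqI) (auto simp: hcomp.rep_eq homogeneous_def in_keys_iff)

lemma hcomp_add: "hcomp d (p + q) = hcomp d p + hcomp d q"
  by (rule poly_mapping_eqI) (auto simp: hcomp.rep_eq lookup_add)

lemma hcomp_diff: "hcomp d (p - q) = hcomp d p - hcomp d q"
  by (rule poly_mapping_eqI) (auto simp: hcomp.rep_eq lookup_minus)

lemma hcomp_0: "hcomp d 0 = 0"
  by (rule poly_mapping_eqI) (simp add: hcomp.rep_eq)

text \<open>
  Both sides are additive in \<open>a\<close>, and a monomial \<open>a\<close> makes the product homogeneous.
\<close>

lemma hcomp_mult_homogeneous:
  assumes "homogeneous e f"
  shows "hcomp d (a * f) = (if e \<le> d then hcomp (d - e) a * f else 0)"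
proof (induction a rule: mpoly_additive_induct)
  case (single m c)
  have "homogeneous (mon_degree m + e) (single m c * f)"
    by (intro homogeneous_mult homogeneous_single assms refl)
  then show ?case
    by (auto simp: hcomp_homogeneous hcomp_homogeneous[OF homogeneous_single])
qed (simp add: distrib_right hcomp_add)

lemma sum_hcomp:
  assumes "\<And>m. m \<in> keys p \<Longrightarrow> mon_degree m \<le> N"
  shows "(\<Sum>d\<le>N. hcomp d p) = p"
  by (rule poly_mapping_eqI) (use assms in \<open>auto simp: lookup_sum hcomp.rep_eq in_keys_iff\<close>)

text \<open>
  An element of the ideal is a combination of forms, and taking a homogeneous component of it amounts to
  taking suitable components of the coefficients.
\<close>

lemma homogeneous_ideal_hcomp:
  assumes "homogeneous_ideal J" "p \<in> J"
  shows "hcomp d p \<in> J"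
proof -
  obtain F where F: "\<And>p. p \<in> F \<Longrightarrow> is_form p" and J: "J = ideal.span F"
    using assms(1) by (auto simp: homogeneous_ideal_def)
  have "p \<in> ideal.span F" using assms(2) J by simp
  then have "hcomp d p \<in> ideal.span F"
  proof (induction rule: ideal.span_induct_alt)
    case base
    show ?case by (simp add: hcomp_0 ideal.span_zero)
  next
    case (step a f q)
    then obtain e where "homogeneous e f" using F by (auto simp: is_form_def)
    then have "hcomp d (a * f) \<in> ideal.span F"
      using step by (auto simp: hcomp_mult_homogeneous ideal.span_zero intro: ideal.span_scale ideal.span_base)
    then show ?case
      using step by (simp add: hcomp_add ideal.span_add)
  qed
  then show ?thesis by (simp add: J)
qed

section \<open>Dehomogenization\<close>

lemma linear_change_homogeneous:
  assumes "homogeneous d p"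
  shows "homogeneous d (linear_change A p)"
proof -
  have lin: "homogeneous k ((\<Sum>w\<in>UNIV. Const (A $ v $ w) * Var w) ^ k)" for v k
    using homogeneous_power[OF homogeneous_sum[OF homogeneous_Const_mult[OF homogeneous_Var]]] by simp
  have "homogeneous (mon_degree m) (\<Prod>v\<in>UNIV. (\<Sum>w\<in>UNIV. Const (A $ v $ w) * Var w) ^ lookup m v)" for m
    unfolding mon_degree_def using lin by (intro homogeneous_prod) auto
  then show ?thesis
    unfolding linear_change_def subst_vars_def
    using assms by (intro homogeneous_sum homogeneous_Const_mult) (auto simp: homogeneous_def)
qed

lemma linear_change_linear_change:
  "linear_change B (linear_change A p) = linear_change (A ** B) p"
proof -
  have "(\<Sum>w\<in>UNIV. Const (A $ v $ w) * (\<Sum>u\<in>UNIV. Const (B $ w $ u) * Var u))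
      = (\<Sum>u\<in>UNIV. Const ((A ** B) $ v $ u) * Var u)" for v
  proof -
    have "(\<Sum>w\<in>UNIV. Const (A $ v $ w) * (\<Sum>u\<in>UNIV. Const (B $ w $ u) * Var u))
        = (\<Sum>w\<in>UNIV. \<Sum>u\<in>UNIV. Const (A $ v $ w * B $ w $ u) * Var u)"
      unfolding Const_mult sum_distrib_left mult.assoc by (rule refl)
    also have "\<dots> = (\<Sum>u\<in>UNIV. \<Sum>w\<in>UNIV. Const (A $ v $ w * B $ w $ u) * Var u)"
      by (rule sum.swap)
    finally show ?thesis
      by (simp add: matrix_matrix_mult_def Const_sum sum_distrib_right)
  qed
  then show ?thesis
    by (simp add: linear_change_def subst_vars_subst_vars subst_vars_sum subst_vars_mult
        subst_vars_Const subst_vars_Var)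
qed

lemma linear_change_mat_1:
  fixes p :: "('v::finite, 'k::comm_ring_1) mpoly"
  shows "linear_change (mat 1) p = p"
proof -
  have "(\<Sum>w\<in>UNIV. Const (mat 1 $ v $ w) * Var w) = (Var v :: ('v, 'k) mpoly)" for v :: 'v
  proof -
    have "(\<Sum>w\<in>UNIV. Const (mat 1 $ v $ w) * Var w) = (\<Sum>w\<in>UNIV. if w = v then (Var w :: ('v, 'k) mpoly) else 0)"
      by (rule sum.cong) (auto simp: mat_def Const_0 Const_1)
    then show ?thesis by simp
  qed
  then show ?thesis
    by (simp add: linear_change_def subst_vars_Var_id)
qed

lemma linear_change_eq_0:
  assumes "invertible A" "linear_change A p = 0"
  shows "p = 0"
proof -
  obtain B where "A ** B = mat 1" using assms(1) by (auto simp: invertible_def)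
  then have "p = linear_change B (linear_change A p)"
    by (simp add: linear_change_linear_change linear_change_mat_1)
  also have "\<dots> = 0" using assms(2) by (simp add: linear_change_def subst_vars_0)
  finally show ?thesis .
qed

lemma dehom_add: "dehom v A (p + q) = dehom v A p + dehom v A q"
  and dehom_diff: "dehom v A (p - q) = dehom v A p - dehom v A q"
  and dehom_mult: "dehom v A (p * q) = dehom v A p * dehom v A q"
  and dehom_power: "dehom v A (p ^ k) = dehom v A p ^ k"
  and dehom_sum: "dehom v A (\<Sum>i\<in>X. h i) = (\<Sum>i\<in>X. dehom v A (h i))"
proof -
  have sd: "subst_vars \<sigma> (p - q) = subst_vars \<sigma> p - subst_vars \<sigma> q" for \<sigma> p q
    using subst_vars_add[of \<sigma> "p - q" q] by (metis add_diff_cancel_right' diff_add_cancel)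
  show "dehom v A (p + q) = dehom v A p + dehom v A q"
    and "dehom v A (p - q) = dehom v A p - dehom v A q"
    and "dehom v A (p * q) = dehom v A p * dehom v A q"
    and "dehom v A (p ^ k) = dehom v A p ^ k"
    and "dehom v A (\<Sum>i\<in>X. h i) = (\<Sum>i\<in>X. dehom v A (h i))"
    by (simp_all add: dehom_def linear_change_def subst_vars_add sd subst_vars_mult
        subst_vars_power subst_vars_sum)
qed

lemma dehom_adapted: "adapted_coords v z A \<Longrightarrow> dehom v A z = 1"
  by (simp add: adapted_coords_def dehom_def subst_vars_Var)

text \<open>
  No cancellation is possible when a variable is set to \<open>1\<close> in a form: the degree and the exponents
  of the other variables determine the exponent of that variable, so distinct monomials of \<open>p\<close> keep
  distinct images.
\<close>

lemma set_variable_to_1_homogeneous_eq_0: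
  fixes p :: "('v::finite, 'k::comm_ring_1) mpoly"
  assumes hom: "homogeneous d p"
    and zero: "subst_vars (\<lambda>v. if v = v0 then 1 else Var v) p = 0"
  shows "p = 0"
proof (rule poly_mapping_eqI)
  fix m
  define \<rho> where "\<rho> m = (m::'v \<Rightarrow>\<^sub>0 nat) - single v0 (lookup m v0)" for m
  have lookup_\<rho>: "lookup (\<rho> m) v = (if v = v0 then 0 else lookup m v)" for m v
    by (simp add: \<rho>_def lookup_minus lookup_single)
  have inj: "m' = m" if "\<rho> m' = \<rho> m" "mon_degree m' = mon_degree m" for m m'
  proof -
    have other: "lookup m' v = lookup m v" if "v \<noteq> v0" for v
      using lookup_\<rho>[of m v] lookup_\<rho>[of m' v] \<open>\<rho> m' = \<rho> m\<close> that by simp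
    have "lookup k v0 = mon_degree k - (\<Sum>v\<in>UNIV - {v0}. lookup k v)" for k
      by (simp add: mon_degree_def sum.remove[of UNIV v0])
    moreover have "(\<Sum>v\<in>UNIV - {v0}. lookup m' v) = (\<Sum>v\<in>UNIV - {v0}. lookup m v)"
      by (rule sum.cong) (auto simp: other)
    ultimately have "lookup m' v0 = lookup m v0"
      using that(2) by simp
    with other show ?thesis
      by (intro poly_mapping_eqI) metis
  qed
  have "(\<Prod>v\<in>UNIV. (if v = v0 then 1 else Var v) ^ lookup m v) = single (\<rho> m) (1::'k)" for m
    unfolding monomial_eq_prod by (rule prod.cong) (auto simp: lookup_\<rho>)
  then have "subst_vars (\<lambda>v. if v = v0 then 1 else Var v) p
      = (\<Sum>m\<in>keys p. single (\<rho> m) (lookup p m))"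
    by (simp add: subst_vars_def flip: single_eq_Const_mult)
  then have "(\<Sum>m'\<in>keys p. lookup (single (\<rho> m') (lookup p m')) (\<rho> m)) = 0"
    using zero by (simp flip: lookup_sum)
  moreover have "(\<Sum>m'\<in>keys p. lookup (single (\<rho> m') (lookup p m')) (\<rho> m)) = lookup p m"
    if "m \<in> keys p"
  proof -
    have "(\<Sum>m'\<in>keys p. lookup (single (\<rho> m') (lookup p m')) (\<rho> m))
        = (\<Sum>m'\<in>keys p. if m' = m then lookup p m' else 0)"
      using inj that hom by (intro sum.cong refl) (auto simp: lookup_single homogeneous_def when_def)
    then show ?thesis using that by simp
  qed
  ultimately show "lookup p m = lookup 0 m"
    by (cases "m \<in> keys p") (auto simp: in_keys_iff)
qed

lemma dehom_homogeneous_eq_0: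
  assumes "homogeneous d p" "invertible A" "dehom v A p = 0"
  shows "p = 0"
  using assms linear_change_eq_0 linear_change_homogeneous set_variable_to_1_homogeneous_eq_0
  unfolding dehom_def by blast

text \<open>
  Let \<open>f\<close> and \<open>h \<in> J\<close> have the same dehomogenization. Multiplying the component of degree \<open>d\<close> of
  \<open>f - h\<close> by \<open>z ^ (N - d)\<close> does not affect its dehomogenization, as \<open>z\<close> becomes \<open>1\<close>, but gives a
  form \<open>q\<close> of degree \<open>N\<close>. On forms dehomogenization is injective, so \<open>q = 0\<close>; this equation writes
  \<open>z ^ (N - e) * f\<close> as a combination of components of \<open>h\<close>, which lie in \<open>J\<close>.
\<close>

lemma dehom_mem_imp_power_mult_mem:
  assumes J: "ideal.subspace J" "homogeneous_ideal J"
    and z: "linear_form z" "adapted_coords v z A"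
    and f: "homogeneous e f" "dehom v A f \<in> dehom v A ` J"
  obtains k where "z ^ k * f \<in> J"
proof -
  obtain h where h: "h \<in> J" "dehom v A f = dehom v A h"
    using f(2) by auto
  define N where "N = Max (insert e (mon_degree ` keys (f - h)))"
  have N: "e \<le> N" "\<And>m. m \<in> keys (f - h) \<Longrightarrow> mon_degree m \<le> N"
    by (auto simp: N_def)
  define q where "q = (\<Sum>d\<le>N. z ^ (N - d) * hcomp d (f - h))"
  have "homogeneous (N - d + d) (z ^ (N - d) * hcomp d (f - h))" for d
    using homogeneous_power[OF z(1), of "N - d"] by (intro homogeneous_mult homogeneous_hcomp) auto
  then have "homogeneous N q"
    unfolding q_def by (intro homogeneous_sum) (metis atMost_iff le_add_diff_inverse2)
  have "dehom v A q = (\<Sum>d\<le>N. dehom v A (hcomp d (f - h)))"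
    by (simp add: q_def dehom_sum dehom_mult dehom_power dehom_adapted[OF z(2)])
  also have "\<dots> = dehom v A (f - h)"
    using N(2) by (simp flip: dehom_sum add: sum_hcomp)
  also have "\<dots> = 0" by (simp add: dehom_diff h)
  finally have "q = 0"
    using \<open>homogeneous N q\<close> z(2) dehom_homogeneous_eq_0 by (auto simp: adapted_coords_def)
  have "q = (\<Sum>d\<le>N. z ^ (N - d) * hcomp d f) - (\<Sum>d\<le>N. z ^ (N - d) * hcomp d h)"
    by (simp add: q_def hcomp_diff right_diff_distrib sum_subtractf)
  also have "(\<Sum>d\<le>N. z ^ (N - d) * hcomp d f) = (\<Sum>d\<le>N. if d = e then z ^ (N - d) * f else 0)"
    by (rule sum.cong) (auto simp: hcomp_homogeneous[OF f(1)])
  also have "\<dots> = z ^ (N - e) * f"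
    using N(1) by simp
  finally have "z ^ (N - e) * f = (\<Sum>d\<le>N. z ^ (N - d) * hcomp d h)"
    using \<open>q = 0\<close> by simp
  also have "\<dots> \<in> J"
    by (intro ideal.subspace_sum ideal.subspace_scale J(1) homogeneous_ideal_hcomp[OF J(2) h(1)])
  finally show ?thesis by (rule that)
qed

text \<open>
  As \<open>z\<close> becomes \<open>1\<close>, the polynomials \<open>f\<close> and \<open>z ^ k * f\<close> have the same dehomogenization.
\<close>

lemma dehom_image_eq_if_power_mult_mem:
  assumes H: "ideal.subspace H" and z: "adapted_coords v z A" and f: "z ^ k * f \<in> H"
  shows "dehom v A ` H = dehom v A ` ideal.span (H \<union> {f})"
proof
  show "dehom v A ` H \<subseteq> dehom v A ` ideal.span (H \<union> {f})"
    by (intro image_mono) (auto intro: ideal.span_base)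
  have "dehom v A p \<in> dehom v A ` H" if "p \<in> ideal.span (H \<union> {f})" for p
  proof -
    have "p \<in> ideal.span (insert f H)" using that by simp
    then obtain a where "p - a * f \<in> ideal.span H"
      by (auto simp: ideal.span_breakdown_eq)
    then have pa: "p - a * f \<in> H"
      using H by (metis ideal.span_eq_iff)
    have "dehom v A p = dehom v A (p - a * f) + dehom v A a * dehom v A (z ^ k * f)"
      by (simp add: dehom_diff dehom_mult dehom_power dehom_adapted[OF z])
    also have "\<dots> = dehom v A ((p - a * f) + a * (z ^ k * f))"
      by (simp add: dehom_add dehom_mult)
    finally show ?thesis
      using ideal.subspace_add[OF H pa ideal.subspace_scale[OF H f]] by simp
  qed
  then show "dehom v A ` ideal.span (H \<union> {f}) \<subseteq> dehom v A ` H"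
    by auto
qed

lemma linear_form_eq:
  assumes "linear_form z"
  shows "z = (\<Sum>v\<in>UNIV. Const (lookup z (single v 1)) * Var v)"
proof (rule poly_mapping_eqI)
  fix m
  have rhs: "lookup (\<Sum>v\<in>UNIV. Const (lookup z (single v 1)) * Var v) m
      = (\<Sum>v\<in>UNIV. if single v 1 = m then lookup z m else 0)"
    by (auto simp: lookup_sum lookup_Const_mult Var_def lookup_single when_def intro!: sum.cong)
  show "lookup z m = lookup (\<Sum>v\<in>UNIV. Const (lookup z (single v 1)) * Var v) m"
  proof (cases "m \<in> keys z")
    case True
    then have deg: "mon_degree m = 1" using assms by (simp add: homogeneous_def)
    then obtain u where u: "lookup m u \<noteq> 0"
      unfolding mon_degree_def by (metis sum.neutral zero_neq_one)
    have "mon_degree m = lookup m u + (\<Sum>v\<in>UNIV - {u}. lookup m v)"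
      by (simp add: mon_degree_def sum.remove)
    then have "lookup m u = 1" "(\<Sum>v\<in>UNIV - {u}. lookup m v) = 0" using u deg by linarith+
    then have "lookup m v = (1 when v = u)" for v
      by (cases "v = u") auto
    then have m: "m = single u 1"
      by (intro poly_mapping_eqI) (simp add: lookup_single when_def eq_commute)
    have "(single v 1 = m) = (v = u)" for v
      using keys_single[of v "1::nat"] keys_single[of u "1::nat"] m by (metis singleton_inject zero_neq_one)
    then show ?thesis unfolding rhs by simp
  next
    case False
    then show ?thesis unfolding rhs by (simp add: in_keys_iff cong: if_cong)
  qed
qed

lemma linear_form_mem_irrelevant_ideal:
  assumes "linear_form z"
  shows "z \<in> irrelevant_ideal"
  unfolding irrelevant_ideal_def
  by (subst linear_form_eq[OF assms], intro ideal.span_sum ideal.span_scale ideal.span_base) auto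

lemma adapted_coords_exist:
  fixes z :: "('v::finite, 'k::field) mpoly"
  assumes z: "linear_form z" "z \<noteq> 0"
  obtains A where "adapted_coords v0 z A"
proof -
  define c where "c = (\<chi> v. lookup z (single v 1))"
  have z_eq: "z = (\<Sum>v\<in>UNIV. Const (c $ v) * Var v)"
    unfolding c_def vec_lambda_beta by (rule linear_form_eq[OF z(1)])
  then obtain u where u: "c $ u \<noteq> 0"
    using z(2) by (metis (no_types, lifting) Const_0 mult_zero_left sum.neutral)
  \<comment> \<open>The coordinate change is inverse to a matrix \<open>B\<close> whose row \<open>v0\<close> holds the coefficients of
    \<open>z\<close>; the other rows run through the unit vectors except the one at an index \<open>u\<close> where the
    coefficient is nonzero, so that the rows are independent.\<close>
  define \<pi> where "\<pi> v = (if v = u then v0 else v)" for v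
  define B where "B = (\<chi> v. if v = v0 then c else axis (\<pi> v) 1)"
  have "x = 0" if Bx: "B *v x = 0" for x
  proof -
    have row: "(\<Sum>w\<in>UNIV. B $ v $ w * x $ w) = 0" for v
      using Bx by (simp add: vec_eq_iff matrix_vector_mult_def)
    have \<pi>: "x $ \<pi> v = 0" if "v \<noteq> v0" for v
    proof -
      have "(\<Sum>w\<in>UNIV. B $ v $ w * x $ w) = (\<Sum>w\<in>UNIV. if w = \<pi> v then x $ w else 0)"
        using that by (intro sum.cong) (auto simp: B_def axis_def)
      then show ?thesis using row[of v] by simp
    qed
    have other: "x $ w = 0" if "w \<noteq> u" for w
    proof (cases "w = v0")
      case True
      with that have "u \<noteq> v0" by simp
      from \<pi>[OF this] True show ?thesis by (simp add: \<pi>_def)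
    next
      case False
      from \<pi>[OF False] that show ?thesis by (simp add: \<pi>_def)
    qed
    have "(\<Sum>w\<in>UNIV. c $ w * x $ w) = c $ u * x $ u + (\<Sum>w\<in>UNIV - {u}. c $ w * x $ w)"
      by (simp add: sum.remove)
    also have "(\<Sum>w\<in>UNIV - {u}. c $ w * x $ w) = 0"
      by (rule sum.neutral) (auto simp: other)
    finally have "x $ u = 0" using row[of v0] u by (simp add: B_def)
    with other show ?thesis by (metis vec_eq_iff zero_index)
  qed
  then obtain A where AB: "A ** B = mat 1"
    using matrix_left_invertible_ker[of B] by auto
  then have BA: "B ** A = mat 1"
    by (simp add: matrix_left_right_inverse)
  have "linear_change B (Var v0) = z"
    by (simp add: linear_change_def subst_vars_Var z_eq B_def)
  then have "linear_change A z = linear_change A (linear_change B (Var v0))"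
    by simp
  also have "\<dots> = Var v0"
    by (simp add: linear_change_linear_change BA linear_change_mat_1)
  finally have "adapted_coords v0 z A"
    using AB BA by (auto simp: adapted_coords_def invertible_def)
  then show ?thesis by (rule that)
qed

section \<open>Saturation\<close>

text \<open>
  For each \<open>k\<close> the polynomials without terms of degree below \<open>k\<close> form an ideal \<open>D k\<close>, and
  \<open>D i * D j \<subseteq> D (i + j)\<close>.
\<close>

lemma ideal_power_irrelevant_mon_degree:
  fixes p :: "('v::finite, 'k::comm_ring_1) mpoly"
  assumes "p \<in> ideal_power irrelevant_ideal t" "m \<in> keys p"
  shows "t \<le> mon_degree m"
  using assms
proof (induction t arbitrary: p m)
  case 0
  then show ?case by simp
next
  case (Suc t)
  define D where "D k = {p :: ('v, 'k) mpoly. \<forall>m\<in>keys p. k \<le> mon_degree m}" for k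
  have D_mult: "a * b \<in> D (i + j)" if "a \<in> D i" "b \<in> D j" for a b i j
    using that keys_mult[of a b] by (fastforce simp: D_def mon_degree_add)
  have D_0: "c \<in> D 0" for c by (simp add: D_def)
  have ideal_D: "ideal.subspace (D k)" for k
    unfolding ideal.subspace_def
  proof (intro conjI ballI allI)
    show "0 \<in> D k" by (simp add: D_def)
    show "x + y \<in> D k" if "x \<in> D k" "y \<in> D k" for x y
      using that Poly_Mapping.keys_add[of x y] by (auto simp: D_def)
    show "c * x \<in> D k" if "x \<in> D k" for c x
      using D_mult[OF D_0 that] by simp
  qed
  have "Var v \<in> D 1" for v
    using homogeneous_Var[of v] by (auto simp: D_def homogeneous_def)
  then have M: "irrelevant_ideal \<subseteq> D 1"
    unfolding irrelevant_ideal_def by (intro ideal.span_minimal ideal_D) auto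
  have "ideal_power irrelevant_ideal t \<subseteq> D t"
    using Suc.IH by (auto simp: D_def)
  then have "a * b \<in> D (Suc t)" if "a \<in> irrelevant_ideal" "b \<in> ideal_power irrelevant_ideal t" for a b
    using D_mult[of a 1 b t] M that by auto
  then have "ideal_power irrelevant_ideal (Suc t) \<subseteq> D (Suc t)"
    unfolding ideal_power.simps by (intro ideal.span_minimal ideal_D) auto
  then show ?case using Suc.prems by (auto simp: D_def)
qed

lemma power_mem_ideal_power: "z \<in> A \<Longrightarrow> z ^ t \<in> ideal_power A t"
  by (induction t) (auto intro: ideal.span_base)

text \<open>
  A monomial whose degree reaches the sum of the exponents \<open>k v\<close> is divisible by \<open>Var v ^ k v\<close> for
  some \<open>v\<close>.
\<close>

lemma mult_mem_if_Var_power_mult_mem: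
  fixes J :: "('v::finite, 'k::comm_ring_1) mpoly set"
  assumes J: "ideal.subspace J" and f: "\<And>v. \<exists>k. Var v ^ k * f \<in> J"
  obtains t where "\<And>p. (\<And>m. m \<in> keys p \<Longrightarrow> t \<le> mon_degree m) \<Longrightarrow> f * p \<in> J"
proof -
  obtain k where k: "\<And>v. Var v ^ k v * f \<in> J" using f by metis
  have monomial: "single m c * f \<in> J" if "(\<Sum>v\<in>UNIV. k v) \<le> mon_degree m" for m c
  proof -
    have "\<exists>v. k v \<le> lookup m v"
    proof (rule ccontr)
      assume "\<not> ?thesis"
      then have "mon_degree m < (\<Sum>v\<in>UNIV. k v)"
        unfolding mon_degree_def by (intro sum_strict_mono) (auto simp: not_le)
      then show False using that by simp
    qed
    then obtain v where v: "k v \<le> lookup m v" by blast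
    have "m = (m - single v (k v)) + single v (k v)"
      using v by (intro poly_mapping_eqI) (auto simp: lookup_add lookup_minus lookup_single when_def)
    then have "single m c = single (m - single v (k v)) c * Var v ^ k v"
      by (metis Var_power mult.right_neutral mult_single)
    then have "single m c * f = single (m - single v (k v)) c * (Var v ^ k v * f)"
      by (simp add: mult.assoc)
    also have "\<dots> \<in> J" by (intro ideal.subspace_scale J k)
    finally show ?thesis .
  qed
  show ?thesis
  proof (rule that)
    fix p :: "('v, 'k) mpoly" assume p: "\<And>m. m \<in> keys p \<Longrightarrow> (\<Sum>v\<in>UNIV. k v) \<le> mon_degree m"
    have "f * p = (\<Sum>m\<in>keys p. single m (lookup p m)) * f"
      by (simp flip: sum_of_monomials add: mult.commute)
    also have "\<dots> \<in> J"
      unfolding sum_distrib_right by (intro ideal.subspace_sum J monomial p)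
    finally show "f * p \<in> J" .
  qed
qed

text \<open>
  This turns the quantification over a power of the irrelevant ideal into one condition per variable, for
  which closure properties are immediate.
\<close>

lemma saturation_iff:
  fixes J :: "('v::finite, 'k::comm_ring_1) mpoly set"
  assumes J: "ideal.subspace J"
  shows "f \<in> saturation J \<longleftrightarrow> (\<forall>v. \<exists>k. Var v ^ k * f \<in> J)"
proof
  assume "f \<in> saturation J"
  then obtain t where t: "\<And>p. p \<in> ideal_power irrelevant_ideal t \<Longrightarrow> f * p \<in> J"
    by (auto simp: saturation_def)
  have "Var v ^ t * f \<in> J" for v
    using t[OF power_mem_ideal_power[of "Var v"]]
    by (simp add: mult.commute irrelevant_ideal_def ideal.span_base)
  then show "\<forall>v. \<exists>k. Var v ^ k * f \<in> J" by blast
next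
  assume "\<forall>v. \<exists>k. Var v ^ k * f \<in> J"
  then obtain t where "\<And>p. (\<And>m. m \<in> keys p \<Longrightarrow> t \<le> mon_degree m) \<Longrightarrow> f * p \<in> J"
    using mult_mem_if_Var_power_mult_mem[OF J, of f] by metis
  then have "(\<lambda>p. f * p) ` ideal_power irrelevant_ideal t \<subseteq> J"
    using ideal_power_irrelevant_mon_degree by auto
  then show "f \<in> saturation J" by (auto simp: saturation_def)
qed

lemma subspace_saturation:
  fixes J :: "('v::finite, 'k::comm_ring_1) mpoly set"
  assumes J: "ideal.subspace J"
  shows "ideal.subspace (saturation J)"
  unfolding ideal.subspace_def
proof (intro conjI ballI allI)
  show "0 \<in> saturation J" using J by (simp add: saturation_iff ideal.subspace_0)
  show "c * x \<in> saturation J" if "x \<in> saturation J" for c x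
    using that ideal.subspace_scale[OF J, of _ c] by (auto simp: saturation_iff[OF J] mult.left_commute)
  show "x + y \<in> saturation J" if "x \<in> saturation J" "y \<in> saturation J" for x y
    unfolding saturation_iff[OF J]
  proof
    fix v
    obtain k l where kl: "Var v ^ k * x \<in> J" "Var v ^ l * y \<in> J"
      using \<open>x \<in> _\<close> \<open>y \<in> _\<close> unfolding saturation_iff[OF J] by blast
    have "Var v ^ (k + l) * (x + y) = Var v ^ l * (Var v ^ k * x) + Var v ^ k * (Var v ^ l * y)"
      by (simp add: power_add algebra_simps)
    also have "\<dots> \<in> J"
      by (rule ideal.subspace_add[OF J ideal.subspace_scale[OF J kl(1)] ideal.subspace_scale[OF J kl(2)]])
    finally show "\<exists>k. Var v ^ k * (x + y) \<in> J" by blast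
  qed
qed

lemma saturation_saturated:
  fixes J :: "('v::finite, 'k::comm_ring_1) mpoly set"
  assumes J: "ideal.subspace J" and p: "\<And>v. \<exists>k. Var v ^ k * p \<in> saturation J"
  shows "p \<in> saturation J"
  unfolding saturation_iff[OF J]
proof
  fix v
  obtain k where "Var v ^ k * p \<in> saturation J" using p by blast
  then obtain l where "Var v ^ l * (Var v ^ k * p) \<in> J" unfolding saturation_iff[OF J] by blast
  then have "Var v ^ (l + k) * p \<in> J" by (simp add: power_add mult.assoc)
  then show "\<exists>k. Var v ^ k * p \<in> J" by blast
qed

section \<open>Dickson's lemma and the ascending chain condition\<close>

lemma nat_sequence_mono_subseq:
  fixes f :: "nat \<Rightarrow> nat"
  obtains r :: "nat \<Rightarrow> nat" where "strict_mono r" "mono (f \<circ> r)"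
proof -
  obtain r :: "nat \<Rightarrow> nat" where r: "strict_mono r" "monoseq (\<lambda>n. f (r n))"
    using seq_monosub by blast
  show ?thesis
  proof (cases "\<forall>m n. m \<le> n \<longrightarrow> f (r m) \<le> f (r n)")
    case True
    then have "mono (f \<circ> r)" by (auto simp: mono_def)
    with r(1) show ?thesis by (rule that)
  next
    case False
    then have dec: "f (r n) \<le> f (r m)" if "m \<le> n" for m n
      using r(2) that by (auto simp: monoseq_def)
    \<comment> \<open>From the index of its least value on, a nonincreasing sequence of naturals is constant.\<close>
    obtain N where N: "f (r N) \<le> f (r n)" for n
      using ex_has_least_nat[of "\<lambda>_. True" 0 "\<lambda>n. f (r n)"] by auto
    have "f (r (N + n)) = f (r N)" for n
      using dec[of N "N + n"] N[of "N + n"] by simp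
    then have "mono (f \<circ> (\<lambda>n. r (N + n)))"
      by (simp add: mono_def)
    moreover have "strict_mono (\<lambda>n. r (N + n))"
      using r(1) by (simp add: strict_mono_def)
    ultimately show ?thesis by (intro that)
  qed
qed

text \<open>
  Passing to subsequences one variable at a time makes every exponent nondecreasing along a
  subsequence.
\<close>

lemma dickson:
  fixes f :: "nat \<Rightarrow> 'v::finite \<Rightarrow>\<^sub>0 nat"
  obtains i j where "i < j" "\<And>v. lookup (f i) v \<le> lookup (f j) v"
proof -
  have "\<exists>r :: nat \<Rightarrow> nat. strict_mono r \<and> (\<forall>v\<in>V. mono (\<lambda>n. lookup (f (r n)) v))" if "finite V" for V
    using that
  proof (induction V)
    case empty
    have "strict_mono (id :: nat \<Rightarrow> nat)" by (simp add: strict_mono_def)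
    then show ?case by blast
  next
    case (insert u V)
    then obtain r :: "nat \<Rightarrow> nat"
      where r: "strict_mono r" "\<forall>v\<in>V. mono (\<lambda>n. lookup (f (r n)) v)" by blast
    obtain s :: "nat \<Rightarrow> nat" where s: "strict_mono s" "mono ((\<lambda>n. lookup (f (r n)) u) \<circ> s)"
      by (rule nat_sequence_mono_subseq)
    have "strict_mono (r \<circ> s)" using r(1) s(1) by (simp add: strict_mono_def)
    moreover have "\<forall>v\<in>insert u V. mono (\<lambda>n. lookup (f ((r \<circ> s) n)) v)"
      using r(2) s strict_mono_mono[OF s(1)] by (auto simp: mono_def o_def)
    ultimately show ?case by blast
  qed
  from this[OF finite_class.finite_UNIV] obtain r :: "nat \<Rightarrow> nat"
    where r: "strict_mono r" "\<forall>v. mono (\<lambda>n. lookup (f (r n)) v)" by auto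
  show ?thesis
    by (rule that[of "r 0" "r 1"]) (use r in \<open>auto simp: strict_mono_def mono_def\<close>)
qed

lemma exponent_diff_add:
  fixes a b :: "'v \<Rightarrow>\<^sub>0 nat"
  assumes "\<And>v. lookup a v \<le> lookup b v"
  shows "b = (b - a) + a"
  by (rule poly_mapping_eqI) (simp add: lookup_add lookup_minus assms)

text \<open>
  The exponent sets of monomial ideals.
\<close>

definition upset :: "('v \<Rightarrow>\<^sub>0 nat) set \<Rightarrow> bool" where
  "upset U \<longleftrightarrow> (\<forall>m\<in>U. \<forall>a. a + m \<in> U)"

text \<open>
  In a strictly ascending chain every step adds a new exponent \<open>f i\<close>; by Dickson's lemma some
  \<open>f j\<close> is a multiple of an earlier \<open>f i\<close>, so it was not new.
\<close>

lemma wf_upsets: "wf {(V, U :: ('v::finite \<Rightarrow>\<^sub>0 nat) set). upset U \<and> upset V \<and> U \<subset> V}"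
  unfolding wf_iff_no_infinite_down_chain
proof
  assume "\<exists>F. \<forall>i. (F (Suc i), F i) \<in> {(V, U :: ('v \<Rightarrow>\<^sub>0 nat) set). upset U \<and> upset V \<and> U \<subset> V}"
  then obtain F :: "nat \<Rightarrow> ('v \<Rightarrow>\<^sub>0 nat) set"
    where F: "\<And>i. upset (F i)" "\<And>i. F i \<subset> F (Suc i)"
    by (simp add: case_prod_beta) blast
  have "\<exists>m. m \<in> F (Suc i) - F i" for i using F(2)[of i] by auto
  then obtain f where f: "\<And>i. f i \<in> F (Suc i) - F i" by metis
  obtain i j where ij: "i < j" "\<And>v. lookup (f i) v \<le> lookup (f j) v" by (rule dickson[of f]) blast
  have "F (Suc i) \<subseteq> F j"
    by (rule lift_Suc_mono_le[of F]) (use ij(1) F(2)[THEN psubset_imp_subset] in simp_all)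
  then have "f i \<in> F j" using f[of i] by auto
  then have "f j \<in> F j"
    using F(1)[of j] exponent_diff_add[OF ij(2)] unfolding upset_def by metis
  then show False using f[of j] by auto
qed

text \<open>
  A monomial order, encoded by an additive injection into the ordered group of integer polynomials. The
  order of that group looks at the leading coefficient first, so this is the lexicographic order for the
  enumeration \<open>to_nat_on UNIV\<close> of the variables.
\<close>

definition weight :: "('v::finite \<Rightarrow>\<^sub>0 nat) \<Rightarrow> int poly" where
  "weight m = (\<Sum>v\<in>UNIV. monom (int (lookup m v)) (to_nat_on UNIV v))"

lemma weight_add: "weight (a + b) = weight a + weight b"
  by (simp add: weight_def lookup_add add_monom[symmetric] sum.distrib)

lemma coeff_weight: "coeff (weight m) (to_nat_on UNIV v) = int (lookup m v)"
proof -
  have "coeff (weight m) (to_nat_on UNIV v) = (\<Sum>u\<in>UNIV. if u = v then int (lookup m u) else 0)"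
    unfolding weight_def coeff_sum by (intro sum.cong) (auto simp: countable_finite)
  then show ?thesis by simp
qed

lemma weight_inject: "weight a = weight b \<longleftrightarrow> a = b"
proof
  assume "weight a = weight b"
  then have "lookup a v = lookup b v" for v
    using coeff_weight[of a v] coeff_weight[of b v] by simp
  then show "a = b" by (rule poly_mapping_eqI)
qed simp

lemma weight_nonneg: "0 \<le> weight m"
proof -
  have "0 \<le> monom (int n) k" for n k
    by (cases "n = 0") (auto simp: less_eq_poly_def pos_poly_def degree_monom_eq)
  then show ?thesis
    unfolding weight_def by (intro sum_nonneg) simp
qed

text \<open>
  Along an infinite descent, Dickson's lemma gives an exponent that is a multiple of an earlier one; but
  multiples never have smaller weights.
\<close>

lemma wf_weight: "wf {(a, b :: 'v::finite \<Rightarrow>\<^sub>0 nat). weight a < weight b}"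
  unfolding wf_iff_no_infinite_down_chain
proof
  assume "\<exists>f. \<forall>i. (f (Suc i), f i) \<in> {(a, b :: 'v \<Rightarrow>\<^sub>0 nat). weight a < weight b}"
  then obtain f :: "nat \<Rightarrow> 'v \<Rightarrow>\<^sub>0 nat" where f: "\<And>i. weight (f (Suc i)) < weight (f i)" by auto
  obtain i j where ij: "i < j" "\<And>v. lookup (f i) v \<le> lookup (f j) v" by (rule dickson[of f]) blast
  have "weight (f j) < weight (f i)"
    using lift_Suc_mono_less[of "\<lambda>n. - weight (f n)" i j] f ij(1) by simp
  moreover have "weight (f j) = weight (f j - f i) + weight (f i)"
    using exponent_diff_add[OF ij(2)] weight_add by metis
  ultimately show False using weight_nonneg[of "f j - f i"] by simp
qed

definition lead :: "('v::finite \<Rightarrow>\<^sub>0 nat) \<Rightarrow> ('v, 'k::comm_ring_1) mpoly \<Rightarrow> bool" where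
  "lead m p \<longleftrightarrow> m \<in> keys p \<and> (\<forall>m'\<in>keys p. weight m' \<le> weight m)"

definition lead_set :: "('v::finite, 'k::comm_ring_1) mpoly set \<Rightarrow> ('v \<Rightarrow>\<^sub>0 nat) set" where
  "lead_set J = {m. \<exists>p\<in>J. lead m p}"

lemma lead_exists:
  assumes "p \<noteq> 0"
  obtains m where "lead m p"
proof -
  have "finite (weight ` keys p)" "weight ` keys p \<noteq> {}"
    using assms by auto
  from Max_in[OF this] obtain m where "m \<in> keys p" "weight m = Max (weight ` keys p)" by auto
  then have "lead m p" by (simp add: lead_def)
  then show ?thesis by (rule that)
qed

lemma lead_single_mult:
  fixes p :: "('v::finite, 'k::comm_ring_1) mpoly"
  assumes "lead m p"
  shows "lead (a + m) (single a 1 * p)"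
proof -
  have "a + m \<in> keys (single a 1 * p)"
    using assms by (simp add: lead_def in_keys_iff lookup_single_mult)
  moreover have "keys (single a 1 * p) \<subseteq> {a + b |b. b \<in> keys p}"
    using keys_mult[of "single a 1" p] by auto
  ultimately show ?thesis
    using assms by (auto simp: lead_def weight_add)
qed

lemma upset_lead_set:
  assumes "ideal.subspace J"
  shows "upset (lead_set J)"
  using assms lead_single_mult by (fastforce simp: upset_def lead_set_def intro: ideal.subspace_scale)

text \<open>
  Division with remainder by the elements of \<open>V\<close>, as for Groebner bases: as long as the leading monomial of
  \<open>p\<close> is the leading monomial of an element of \<open>V\<close>, subtract a multiple of that element; otherwise move
  the leading term to the remainder. Since \<open>V\<close> is only required to be a \<open>K\<close>-space, this applies
  to ideals, with \<open>T = UNIV\<close>, and also to their components of degree \<open>d\<close>, where \<open>T\<close> keeps the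
  remainder in degree \<open>d\<close>.
\<close>

lemma normal_form:
  fixes p :: "('v::finite, 'k::field) mpoly"
  assumes V: "\<And>p q c. p \<in> V \<Longrightarrow> q \<in> V \<Longrightarrow> p + Const c * q \<in> V" "0 \<in> V"
    and T: "\<And>q. q \<in> V \<Longrightarrow> keys q \<subseteq> T"
    and p: "keys p \<subseteq> T"
  obtains r where "p - r \<in> V" "keys r \<subseteq> T - lead_set V"
proof -
  have step: "\<exists>r. p - r \<in> V \<and> keys r \<subseteq> T - lead_set V" if "lead m p" "keys p \<subseteq> T" for m p
    using that
  proof (induction m arbitrary: p rule: wf_induct_rule[OF wf_weight])
    case (1 m)
    \<comment> \<open>Once the monomial \<open>m\<close> has been removed, the induction hypothesis applies.\<close>
    have smaller: "\<exists>r. q - r \<in> V \<and> keys r \<subseteq> T - lead_set V"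
      if q: "keys q \<subseteq> T" "lookup q m = 0" "\<And>m'. m' \<in> keys q \<Longrightarrow> weight m' \<le> weight m" for q
    proof (cases "q = 0")
      case True
      with V(2) show ?thesis by (intro exI[of _ 0]) simp
    next
      case False
      then obtain m' where m': "lead m' q" by (rule lead_exists)
      then have "m' \<in> keys q" "m' \<noteq> m" using q(2) by (auto simp: lead_def in_keys_iff)
      then have "weight m' < weight m"
        using q(3) weight_inject[of m' m] by (simp add: order_less_le)
      with "1.IH"[of m' q] m' q(1) show ?thesis by simp
    qed
    show ?case
    proof (cases "m \<in> lead_set V")
      case True
      then obtain g where g: "g \<in> V" "lead m g" by (auto simp: lead_set_def)
      define c where "c = lookup p m / lookup g m"
      have keys_q: "keys (p - Const c * g) \<subseteq> keys p \<union> keys g"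
        using keys_diff[of p "Const c * g"] keys_Const_mult[of c g] by blast
      have "lookup g m \<noteq> 0" using g(2) by (auto simp: lead_def in_keys_iff)
      then have "lookup (p - Const c * g) m = 0"
        by (simp add: lookup_minus lookup_Const_mult c_def)
      moreover have "weight m' \<le> weight m" if "m' \<in> keys (p - Const c * g)" for m'
        using that keys_q g(2) \<open>lead m p\<close> by (auto simp: lead_def)
      moreover have "keys (p - Const c * g) \<subseteq> T"
        using keys_q T[OF g(1)] \<open>keys p \<subseteq> T\<close> by blast
      ultimately obtain r where r: "p - Const c * g - r \<in> V" "keys r \<subseteq> T - lead_set V"
        using smaller by blast
      have "p - r = (p - Const c * g - r) + Const c * g" by simp
      then have "p - r \<in> V" using V(1)[OF r(1) g(1), of c] by simp
      with r(2) show ?thesis by blast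
    next
      case False
      let ?t = "single m (lookup p m)"
      have m: "m \<in> T" using \<open>lead m p\<close> \<open>keys p \<subseteq> T\<close> by (auto simp: lead_def)
      have keys_q: "keys (p - ?t) \<subseteq> keys p"
        by (auto simp: in_keys_iff lookup_minus lookup_single when_def split: if_splits)
      then have "keys (p - ?t) \<subseteq> T" "lookup (p - ?t) m = 0"
        "\<And>m'. m' \<in> keys (p - ?t) \<Longrightarrow> weight m' \<le> weight m"
        using \<open>lead m p\<close> \<open>keys p \<subseteq> T\<close> by (auto simp: lookup_minus lead_def)
      then obtain r where r: "p - ?t - r \<in> V" "keys r \<subseteq> T - lead_set V"
        using smaller by blast
      have "keys (?t + r) \<subseteq> T - lead_set V"
        using Poly_Mapping.keys_add[of ?t r] r(2) m False by (auto split: if_splits)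
      moreover have "p - (?t + r) \<in> V" using r(1) by (simp add: diff_diff_eq)
      ultimately show ?thesis by blast
    qed
  qed
  show ?thesis
  proof (cases "p = 0")
    case True
    with V(2) show ?thesis by (intro that[of 0]) auto
  next
    case False
    then show ?thesis using lead_exists step p that by metis
  qed
qed

text \<open>
  The ascending chain condition on ideals, in the form of a well-founded relation whose smaller elements
  are the larger ideals, so that it can be used for Noetherian induction.
\<close>

definition noetherian :: "'a::comm_ring_1 itself \<Rightarrow> bool" where
  "noetherian _ \<longleftrightarrow> wf {(L, J :: 'a set). ideal.subspace J \<and> ideal.subspace L \<and> J \<subset> L}"

text \<open>
  Hilbert's basis theorem. By division with remainder, nested ideals with the same leading
  monomials are equal, so the chain condition carries over from sets of monomials to ideals.
\<close>

lemma noetherian_mpoly: "noetherian TYPE(('v::finite, 'k::field) mpoly)"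
proof -
  have "lead_set J \<subset> lead_set L"
    if J: "ideal.subspace J" and L: "ideal.subspace L" and "J \<subset> L"
    for J L :: "('v, 'k) mpoly set"
  proof -
    have "L \<subseteq> J" if eq: "lead_set J = lead_set L"
    proof
      fix p assume "p \<in> L"
      obtain r where r: "p - r \<in> J" "keys r \<subseteq> UNIV - lead_set J"
        by (rule normal_form[of J UNIV p])
          (auto intro: J ideal.subspace_add ideal.subspace_scale ideal.subspace_0)
      have "r \<in> L"
        using ideal.subspace_diff[OF L \<open>p \<in> L\<close>, of "p - r"] r(1) \<open>J \<subset> L\<close> by auto
      have "r = 0"
      proof (rule ccontr)
        assume "r \<noteq> 0"
        then obtain m where m: "lead m r" by (rule lead_exists)
        then have "m \<in> lead_set J" using \<open>r \<in> L\<close> eq by (auto simp: lead_set_def)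
        moreover have "m \<in> keys r" using m by (simp add: lead_def)
        ultimately show False using r(2) by auto
      qed
      then show "p \<in> J" using r(1) by simp
    qed
    moreover have "lead_set J \<subseteq> lead_set L" using \<open>J \<subset> L\<close> by (auto simp: lead_set_def)
    ultimately show ?thesis using \<open>J \<subset> L\<close> by blast
  qed
  then have "{(L, J :: ('v, 'k) mpoly set). ideal.subspace J \<and> ideal.subspace L \<and> J \<subset> L}
      \<subseteq> inv_image {(V, U). upset U \<and> upset V \<and> U \<subset> V} lead_set"
    by - (rule subsetI, simp add: case_prod_beta inv_image_def upset_lead_set)
  then show ?thesis
    unfolding noetherian_def by (rule wf_subset[OF wf_inv_image[OF wf_upsets]])
qed

section \<open>Hilbert functions are eventually polynomial\<close>

text \<open>
  The falling factorials \<open>b\<^sub>k = x (x - 1) \<dots> (x - k + 1)\<close> satisfy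
  \<open>b\<^sub>k\<^sub>+\<^sub>1(x + 1) - b\<^sub>k\<^sub>+\<^sub>1(x) = (k + 1) b\<^sub>k(x)\<close>. The induction over \<open>p\<close> needs the statement for all
  products \<open>p b\<^sub>k\<close>, because the factor \<open>x\<close> of \<open>x p b\<^sub>k\<close> is absorbed by \<open>x b\<^sub>k = b\<^sub>k\<^sub>+\<^sub>1 + k b\<^sub>k\<close>.
\<close>

lemma poly_antidifference:
  fixes p :: "rat poly"
  obtains q where "\<And>x. poly q (x + 1) - poly q x = poly p x"
proof -
  have "\<exists>q. \<forall>x. poly q (x + 1) - poly q x = poly p x * (\<Prod>i<k. x - of_nat i)" for k
  proof (induction p arbitrary: k)
    case 0
    show ?case by (intro exI[of _ 0]) simp
  next
    case (pCons a p)
    obtain q1 where q1: "\<And>x. poly q1 (x + 1) - poly q1 x = poly p x * (\<Prod>i<Suc k. x - of_nat i)"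
      using pCons.IH by blast
    obtain q2 where q2: "\<And>x. poly q2 (x + 1) - poly q2 x = poly p x * (\<Prod>i<k. x - of_nat i)"
      using pCons.IH by blast
    define b :: "rat poly" where "b = (\<Prod>i<Suc k. [:- of_nat i, 1:])"
    have b: "poly b x = (\<Prod>i<Suc k. x - of_nat i)" for x
      unfolding b_def poly_prod by simp
    have b1: "poly b (x + 1) = (x + 1) * (\<Prod>i<k. x - of_nat i)" for x
      unfolding b prod.lessThan_Suc_shift by simp
    have db: "poly b (x + 1) - poly b x = of_nat (Suc k) * (\<Prod>i<k. x - of_nat i)" for x
    proof -
      have "(x + 1) * t - t * (x - of_nat k) = of_nat (Suc k) * t" for t :: rat
        by (simp add: algebra_simps)
      then show ?thesis unfolding b1 unfolding b prod.lessThan_Suc .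
    qed
    define q where "q = smult (a / of_nat (Suc k)) b + q1 + smult (of_nat k) q2"
    have "poly q (x + 1) - poly q x = poly (pCons a p) x * (\<Prod>i<k. x - of_nat i)" for x
    proof -
      have "poly q (x + 1) - poly q x = a / of_nat (Suc k) * (poly b (x + 1) - poly b x)
          + (poly q1 (x + 1) - poly q1 x) + of_nat k * (poly q2 (x + 1) - poly q2 x)"
        by (simp add: q_def algebra_simps)
      also have "\<dots> = a * (\<Prod>i<k. x - of_nat i) + poly p x * (\<Prod>i<Suc k. x - of_nat i)
          + of_nat k * (poly p x * (\<Prod>i<k. x - of_nat i))"
        unfolding db q1 q2 by (simp del: of_nat_Suc)
      also have "\<dots> = poly (pCons a p) x * (\<Prod>i<k. x - of_nat i)"
        by (simp add: algebra_simps)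
      finally show ?thesis .
    qed
    then show ?case by blast
  qed
  from this[of 0] show ?thesis using that by auto
qed

definition standard_monomials :: "('v::finite \<Rightarrow>\<^sub>0 nat) set \<Rightarrow> nat \<Rightarrow> ('v \<Rightarrow>\<^sub>0 nat) set" where
  "standard_monomials U d = {m. mon_degree m = d \<and> m \<notin> U}"

lemma finite_standard_monomials: "finite (standard_monomials U d)"
  by (rule finite_subset[OF _ finite_mon_degree[of d]]) (auto simp: standard_monomials_def)

lemma split_off_variable:
  assumes "lookup m v \<noteq> 0"
  obtains a where "m = single v (1::nat) + a"
proof
  show "m = single v 1 + (m - single v 1)"
    using assms by (intro poly_mapping_eqI) (auto simp: lookup_add lookup_minus lookup_single when_def)
qed

text \<open>
  Among the monomials outside \<open>U\<close>, those divisible by the variable \<open>v\<close> are \<open>v\<close> times the monomials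
  outside \<open>U : v\<close>, and the others are the monomials outside \<open>U + (v)\<close>. In
  terms of Hilbert functions this is the exact sequence
  \<open>0 \<rightarrow> S/(U : v)(-1) \<rightarrow> S/U \<rightarrow> S/(U + (v)) \<rightarrow> 0\<close>.
\<close>

lemma card_standard_monomials_Suc:
  fixes U :: "('v::finite \<Rightarrow>\<^sub>0 nat) set"
  shows "card (standard_monomials U (Suc d))
    = card (standard_monomials {m. single v 1 + m \<in> U} d)
      + card (standard_monomials (U \<union> {m. lookup m v \<noteq> 0}) (Suc d))"
proof -
  let ?C = "standard_monomials {m. single v 1 + m \<in> U} d"
  let ?D = "standard_monomials (U \<union> {m. lookup m v \<noteq> 0}) (Suc d)"
  have "m \<in> (+) (single v 1) ` ?C \<union> ?D" if "m \<in> standard_monomials U (Suc d)" for m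
  proof (cases "lookup m v = 0")
    case True
    then show ?thesis using that by (simp add: standard_monomials_def)
  next
    case False
    then obtain a where a: "m = single v 1 + a" by (rule split_off_variable)
    then have "a \<in> ?C"
      using that by (simp add: standard_monomials_def mon_degree_add mon_degree_single)
    then show ?thesis using a by blast
  qed
  then have "standard_monomials U (Suc d) = (+) (single v 1) ` ?C \<union> ?D"
    by (auto simp: standard_monomials_def mon_degree_add mon_degree_single)
  moreover have "card ((+) (single v 1) ` ?C) = card ?C"
    by (rule card_image) simp
  moreover have "(+) (single v 1) ` ?C \<inter> ?D = {}"
    by (auto simp: standard_monomials_def lookup_add)
  ultimately show ?thesis
    by (simp add: card_Un_disjoint finite_standard_monomials)
qed

text \<open>
  Noetherian induction on \<open>U\<close>. If \<open>U\<close> contains all variables, the count is \<open>0\<close> in positive degrees.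
  Otherwise choose a variable outside \<open>U\<close> and use the exact sequence. The set \<open>U + (v)\<close> is strictly
  larger than \<open>U\<close>. If \<open>U : v\<close> is larger as well, the count is eventually a sum of
  two polynomials; if \<open>U : v = U\<close>, the differences of consecutive counts are eventually given by a
  polynomial, whose antidifference gives the count up to a constant.
\<close>

lemma card_standard_monomials_eventually_poly:
  fixes U :: "('v::finite \<Rightarrow>\<^sub>0 nat) set"
  assumes "upset U"
  shows "\<exists>P :: rat poly. \<forall>\<^sub>F d in sequentially. of_nat (card (standard_monomials U d)) = poly P (of_nat d)"
  using assms
proof (induction U rule: wf_induct_rule[OF wf_upsets])
  case (1 U)
  show ?case
  proof (cases "\<forall>v. single v 1 \<in> U")
    case True
    have "standard_monomials U d = {}" if "1 \<le> d" for d
    proof -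
      have "m \<in> U" if "mon_degree m = d" for m
      proof -
        have "\<exists>v. lookup m v \<noteq> 0"
        proof (rule ccontr)
          assume "\<not> ?thesis"
          then have "mon_degree m = 0" by (simp add: mon_degree_def)
          with \<open>1 \<le> d\<close> that show False by simp
        qed
        then obtain v where "lookup m v \<noteq> 0" by blast
        then obtain a where a: "m = single v 1 + a" by (rule split_off_variable)
        have "a + single v 1 \<in> U" using True "1.prems" unfolding upset_def by blast
        then show "m \<in> U" by (simp add: a add.commute)
      qed
      then show ?thesis by (auto simp: standard_monomials_def)
    qed
    then have "\<forall>\<^sub>F d in sequentially. of_nat (card (standard_monomials U d)) = poly 0 (of_nat d :: rat)"
      by (intro eventually_sequentiallyI[of 1]) simp
    then show ?thesis by blast
  next
    case False
    then obtain v where v: "single v 1 \<notin> U" by blast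
    let ?U1 = "{m. single v 1 + m \<in> U}" and ?U2 = "U \<union> {m. lookup m v \<noteq> 0}"
    have "single v 1 \<in> ?U2" by simp
    then have U2: "upset ?U2" "U \<subset> ?U2"
      using "1.prems" v by (auto simp: upset_def lookup_add)
    have U1: "upset ?U1" "U \<subseteq> ?U1"
      using "1.prems" by (auto simp: upset_def add.left_commute)
    obtain P2 :: "rat poly" where P2:
      "\<forall>\<^sub>F d in sequentially. of_nat (card (standard_monomials ?U2 d)) = poly P2 (of_nat d)"
      using "1.IH"[of ?U2] "1.prems" U2 by auto
    show ?thesis
    proof (cases "?U1 = U")
      case True
      obtain Q where Q: "\<And>x. poly Q (x + 1) - poly Q x = poly (pcompose P2 [:1, 1:]) x"
        by (rule poly_antidifference[of "pcompose P2 [:1, 1:]"]) blast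
      obtain N where N: "\<And>d. N \<le> d \<Longrightarrow> of_nat (card (standard_monomials ?U2 d)) = poly P2 (of_nat d)"
        using P2 by (auto simp: eventually_sequentially)
      define c where "c = of_nat (card (standard_monomials U N)) - poly Q (of_nat N)"
      have "of_nat (card (standard_monomials U d)) = poly (Q + [:c:]) (of_nat d)" if "N \<le> d" for d
        using that
      proof (induction d rule: dec_induct)
        case base
        show ?case by (simp add: c_def)
      next
        case (step d)
        have "(of_nat (card (standard_monomials U (Suc d))) :: rat)
            = of_nat (card (standard_monomials U d)) + of_nat (card (standard_monomials ?U2 (Suc d)))"
          by (subst card_standard_monomials_Suc[of U d v]) (simp only: True of_nat_add)
        also have "\<dots> = poly (Q + [:c:]) (of_nat d) + poly P2 (of_nat (Suc d))"
          using step N[of "Suc d"] by simp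
        also have "\<dots> = poly (Q + [:c:]) (of_nat (Suc d))"
          using Q[of "of_nat d"] by (simp add: poly_pcompose algebra_simps)
        finally show ?case .
      qed
      then show ?thesis unfolding eventually_sequentially by blast
    next
      case False
      with U1 have "U \<subset> ?U1" by auto
      then obtain P1 :: "rat poly" where P1:
        "\<forall>\<^sub>F d in sequentially. of_nat (card (standard_monomials ?U1 d)) = poly P1 (of_nat d)"
        using "1.IH"[of ?U1] "1.prems" U1 by auto
      obtain N where N: "\<And>d. N \<le> d \<Longrightarrow> of_nat (card (standard_monomials ?U1 d)) = poly P1 (of_nat d)"
          "\<And>d. N \<le> d \<Longrightarrow> of_nat (card (standard_monomials ?U2 d)) = poly P2 (of_nat d)"
        using eventually_conj[OF P1 P2] by (auto simp: eventually_sequentially)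
      have "of_nat (card (standard_monomials U d)) = poly (pcompose P1 [:-1, 1:] + P2) (of_nat d)"
        if "Suc N \<le> d" for d
      proof -
        obtain e where e: "d = Suc e" "N \<le> e" using \<open>Suc N \<le> d\<close> by (cases d) auto
        show ?thesis
          unfolding e(1) card_standard_monomials_Suc[of U e v]
          using N(1)[of e] N(2)[of "Suc e"] e(2) by (simp add: poly_pcompose)
      qed
      then show ?thesis unfolding eventually_sequentially by blast
    qed
  qed
qed

text \<open>
  A nonzero combination of standard monomials has a standard leading monomial, so it is not in \<open>J\<close>; and
  every form of degree \<open>d\<close> is congruent to its remainder under division by \<open>J\<^sub>d\<close>. The homogeneity of \<open>J\<close>
  ensures that every leading monomial of degree \<open>d\<close> is already the leading monomial of an element of \<open>J\<^sub>d\<close>.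
\<close>

lemma graded_quotient_basis_standard_monomials:
  fixes J :: "('v::finite, 'k::field) mpoly set"
  assumes J: "ideal.subspace J" "homogeneous_ideal J"
  shows "graded_quotient_basis J d ((\<lambda>m. single m 1) ` standard_monomials (lead_set J) d)"
    (is "graded_quotient_basis J d (_ ` ?S)")
  unfolding graded_quotient_basis_def
proof (intro conjI allI impI)
  have inj: "inj (\<lambda>m :: 'v \<Rightarrow>\<^sub>0 nat. single m (1::'k))"
    by (rule injI) (metis keys_single singleton_inject zero_neq_one)
  have sum_eq: "(\<Sum>b\<in>(\<lambda>m. single m 1) ` ?S. Const (c b) * b) = (\<Sum>m\<in>?S. single m (c (single m 1)))"
    for c :: "('v, 'k) mpoly \<Rightarrow> 'k"
  proof -
    have "(\<Sum>b\<in>(\<lambda>m. single m 1) ` ?S. Const (c b) * b) = (\<Sum>m\<in>?S. Const (c (single m 1)) * single m 1)"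
      by (subst sum.reindex) (auto intro: inj_on_subset[OF inj])
    then show ?thesis by (simp flip: single_eq_Const_mult)
  qed
  have lookup_eq: "lookup (\<Sum>m\<in>?S. single m (c m)) m = (if m \<in> ?S then c m else 0)"
    for c :: "_ \<Rightarrow> 'k" and m
    by (simp add: lookup_sum lookup_single when_def finite_standard_monomials)
  show "finite ((\<lambda>m. single m 1) ` ?S)"
    by (simp add: finite_standard_monomials)
  show "(\<lambda>m. single m 1) ` ?S \<subseteq> {p. homogeneous d p}"
    by (auto simp: standard_monomials_def homogeneous_single)
  show "\<forall>b\<in>(\<lambda>m. single m 1) ` ?S. c b = 0"
    if "(\<Sum>b\<in>(\<lambda>m. single m 1) ` ?S. Const (c b) * b) \<in> J" for c
  proof -
    define p where "p = (\<Sum>m\<in>?S. single m (c (single m 1)))"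
    have p: "p \<in> J" using that by (simp add: p_def sum_eq)
    have "p = 0"
    proof (rule ccontr)
      assume "p \<noteq> 0"
      then obtain m where m: "lead m p" by (rule lead_exists)
      then have "m \<in> lead_set J" using p by (auto simp: lead_set_def)
      moreover have "m \<in> ?S"
        using m by (auto simp: lead_def in_keys_iff p_def lookup_eq split: if_splits)
      ultimately show False by (simp add: standard_monomials_def)
    qed
    then have "c (single m 1) = 0" if "m \<in> ?S" for m
      using lookup_eq[of "\<lambda>m. c (single m 1)" m] that by (simp add: p_def)
    then show ?thesis by blast
  qed
  show "\<exists>c. p - (\<Sum>b\<in>(\<lambda>m. single m 1) ` ?S. Const (c b) * b) \<in> J" if p: "homogeneous d p" for p
  proof -
    let ?V = "{q \<in> J. homogeneous d q}" and ?T = "{m. mon_degree m = d}"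
    obtain r where r: "p - r \<in> ?V" "keys r \<subseteq> ?T - lead_set ?V"
    proof (rule normal_form[of ?V ?T p])
      show "a + Const c * b \<in> ?V" if "a \<in> ?V" "b \<in> ?V" for a b c
        using that J(1)
        by (auto intro: ideal.subspace_add ideal.subspace_scale homogeneous_add homogeneous_Const_mult)
      show "0 \<in> ?V" using J(1) by (auto intro: ideal.subspace_0 homogeneous_0)
    qed (use p in \<open>auto simp: homogeneous_def\<close>)
    have "m \<in> lead_set ?V" if m: "m \<in> ?T" "m \<in> lead_set J" for m
    proof -
      obtain q where q: "q \<in> J" "lead m q" using m(2) by (auto simp: lead_set_def)
      then have "lead m (hcomp d q)" using m(1) by (auto simp: lead_def keys_hcomp)
      moreover have "hcomp d q \<in> ?V"
        using homogeneous_ideal_hcomp[OF J(2) q(1)] homogeneous_hcomp by auto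
      ultimately show ?thesis by (auto simp: lead_set_def)
    qed
    then have keys_r: "keys r \<subseteq> ?S" using r(2) by (auto simp: standard_monomials_def)
    define c where "c b = lookup r (inv (\<lambda>m. single m (1::'k)) b)" for b
    have "r = (\<Sum>m\<in>?S. single m (lookup r m))"
      by (rule poly_mapping_eqI) (use keys_r in \<open>auto simp: lookup_eq in_keys_iff\<close>)
    also have "\<dots> = (\<Sum>m\<in>?S. single m (c (single m 1)))"
      by (simp add: c_def inv_f_f[OF inj])
    finally show ?thesis using r(1) by (auto simp: sum_eq)
  qed
qed

interpretation mpoly_space: vector_space "\<lambda>c (p :: ('v, 'k::field) mpoly). Const c * p"
  by unfold_locales (simp_all add: Const_add Const_mult Const_1 algebra_simps)

text \<open>
  Replacing the elements of \<open>B\<close> by congruent combinations of \<open>C\<close> keeps them independent, even as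
  polynomials, and puts them into the span of \<open>C\<close>.
\<close>

lemma graded_quotient_basis_card_le:
  fixes J :: "('v::finite, 'k::field) mpoly set"
  assumes J: "ideal.subspace J"
    and B: "graded_quotient_basis J d B" and C: "graded_quotient_basis J d C"
  shows "card B \<le> card C"
proof -
  have fin: "finite B" "finite C" using B C by (auto simp: graded_quotient_basis_def)
  have ind: "\<And>c. (\<Sum>b\<in>B. Const (c b) * b) \<in> J \<Longrightarrow> \<forall>b\<in>B. c b = 0"
    using B by (simp add: graded_quotient_basis_def)
  have "\<exists>c. b - (\<Sum>x\<in>C. Const (c x) * x) \<in> J" if "b \<in> B" for b
    using that B C unfolding graded_quotient_basis_def by blast
  then have "\<exists>a. \<forall>b\<in>B. b - (\<Sum>x\<in>C. Const (a b x) * x) \<in> J"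
    by (intro bchoice) blast
  then obtain a where a: "\<And>b. b \<in> B \<Longrightarrow> b - (\<Sum>x\<in>C. Const (a b x) * x) \<in> J" by blast
  define h where "h b = (\<Sum>x\<in>C. Const (a b x) * x)" for b
  have h_ind: "\<forall>b\<in>B. c b = 0" if "(\<Sum>b\<in>B. Const (c b) * h b) = 0" for c
  proof (rule ind)
    have "(\<Sum>b\<in>B. Const (c b) * b) = (\<Sum>b\<in>B. Const (c b) * (b - h b))"
      using that by (simp add: right_diff_distrib sum_subtractf)
    also have "\<dots> \<in> J"
      using a by (intro ideal.subspace_sum ideal.subspace_scale J) (simp add: h_def)
    finally show "(\<Sum>b\<in>B. Const (c b) * b) \<in> J" .
  qed
  have inj: "inj_on h B"
  proof (rule inj_onI, rule ccontr)
    fix x y assume xy: "x \<in> B" "y \<in> B" "h x = h y" "x \<noteq> y"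
    define c where "c b = (if b = x then 1 else if b = y then -1 else 0 :: 'k)" for b
    have "(\<Sum>b\<in>B. Const (c b) * h b) = (\<Sum>b\<in>{x, y}. Const (c b) * h b)"
      using xy fin by (intro sum.mono_neutral_right) (auto simp: c_def Const_0)
    also have "\<dots> = 0" using xy by (simp add: c_def Const_uminus)
    finally have "c x = 0" using h_ind xy(1) by blast
    then show False by (simp add: c_def)
  qed
  have "\<not> mpoly_space.dependent (h ` B)"
  proof
    assume "mpoly_space.dependent (h ` B)"
    then obtain u y where u: "y \<in> h ` B" "u y \<noteq> 0" "(\<Sum>x\<in>h ` B. Const (u x) * x) = 0"
      using fin(1) by (auto simp: mpoly_space.dependent_finite)
    then have "(\<Sum>b\<in>B. Const (u (h b)) * h b) = 0"
      using inj by (simp add: sum.reindex)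
    then show False using h_ind[of "\<lambda>b. u (h b)"] u(1,2) by blast
  qed
  moreover have "h ` B \<subseteq> mpoly_space.span C"
    unfolding h_def
    by (intro image_subsetI mpoly_space.span_sum mpoly_space.span_scale mpoly_space.span_base)
  ultimately have "card (h ` B) \<le> card C"
    using mpoly_space.independent_span_bound[OF fin(2)] by blast
  then show ?thesis using card_image[OF inj] by simp
qed

lemma hilbert_function_eq_card:
  assumes J: "ideal.subspace J" and B: "graded_quotient_basis J d B"
  shows "hilbert_function J d = card B"
  unfolding hilbert_function_def
  using graded_quotient_basis_card_le[OF J] B by (intro the_equality) (auto intro: le_antisym)

lemma poly_eq_if_eventually_eq:
  fixes P Q :: "rat poly"
  assumes "\<forall>\<^sub>F d in sequentially. poly P (of_nat d) = poly Q (of_nat d)"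
  shows "P = Q"
proof (rule ccontr)
  assume "P \<noteq> Q"
  then have "P - Q \<noteq> 0" by simp
  then have "finite {x. poly (P - Q) x = 0}" by (rule poly_roots_finite)
  moreover obtain N where "\<And>d. N \<le> d \<Longrightarrow> poly P (of_nat d) = poly Q (of_nat d)"
    using assms by (auto simp: eventually_sequentially)
  then have "of_nat ` {N..} \<subseteq> {x. poly (P - Q) x = 0}" by auto
  ultimately have "finite ((of_nat :: nat \<Rightarrow> rat) ` {N..})" by (rule rev_finite_subset)
  then show False using finite_imageD[of "of_nat :: nat \<Rightarrow> rat" "{N..}"] by (simp add: inj_on_def infinite_Ici)
qed

lemma hilbert_polynomial:
  fixes J :: "('v::finite, 'k::field) mpoly set"
  assumes J: "ideal.subspace J" "homogeneous_ideal J"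
  shows "\<forall>\<^sub>F d in sequentially. of_nat (hilbert_function J d) = poly (hilbert_polynomial J) (of_nat d)"
proof -
  have inj: "inj_on (\<lambda>m :: 'v \<Rightarrow>\<^sub>0 nat. single m (1::'k)) S" for S
    by (rule inj_onI) (metis keys_single singleton_inject zero_neq_one)
  have "hilbert_function J d = card (standard_monomials (lead_set J) d)" for d
    using hilbert_function_eq_card[OF J(1) graded_quotient_basis_standard_monomials[OF J]]
    by (simp add: card_image[OF inj])
  then obtain P :: "rat poly"
    where P: "\<forall>\<^sub>F d in sequentially. of_nat (hilbert_function J d) = poly P (of_nat d)"
    using card_standard_monomials_eventually_poly[OF upset_lead_set[OF J(1)]] by auto
  show ?thesis
    unfolding hilbert_polynomial_def
  proof (rule theI[where P = "\<lambda>P. \<forall>\<^sub>F d in sequentially. of_nat (hilbert_function J d) = poly P (of_nat d)", OF P])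
    fix Q :: "rat poly"
    assume Q: "\<forall>\<^sub>F d in sequentially. of_nat (hilbert_function J d) = poly Q (of_nat d)"
    have "\<forall>\<^sub>F d in sequentially. poly Q (of_nat d) = poly P (of_nat d)"
      using Q P by eventually_elim simp
    then show "Q = P" by (rule poly_eq_if_eventually_eq)
  qed
qed

text \<open>
  In a large degree \<open>d\<close> the standard monomials of \<open>I\<close> are among those of \<open>H\<close> and equally many, so
  they form a basis of both graded quotients. Let \<open>p \<in> I\<close> be a form of degree \<open>d\<close>, congruent modulo
  \<open>H\<close> to a combination of them; the combination lies in \<open>I\<close>, so it is \<open>0\<close>.
\<close>

lemma hilbert_polynomial_eq_imp_eventually_eq:
  fixes H I :: "('v::finite, 'k::field) mpoly set"
  assumes H: "ideal.subspace H" "homogeneous_ideal H"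
    and I: "ideal.subspace I" "homogeneous_ideal I"
    and sub: "H \<subseteq> I" and eq: "hilbert_polynomial I = hilbert_polynomial H"
  shows "\<forall>\<^sub>F d in sequentially. \<forall>p\<in>I. homogeneous d p \<longrightarrow> p \<in> H"
  using hilbert_polynomial[OF H] hilbert_polynomial[OF I]
proof eventually_elim
  case (elim d)
  then have card_eq: "hilbert_function H d = hilbert_function I d"
    using eq by (metis of_nat_eq_iff)
  show ?case
  proof (intro ballI impI)
    fix p assume p: "p \<in> I" "homogeneous d p"
    let ?B = "\<lambda>J :: ('v, 'k) mpoly set. (\<lambda>m. single m (1::'k)) ` standard_monomials (lead_set J) d"
    have basis: "graded_quotient_basis H d (?B H)" "graded_quotient_basis I d (?B I)"
      by (intro graded_quotient_basis_standard_monomials H I)+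
    have "lead_set H \<subseteq> lead_set I" using sub by (auto simp: lead_set_def)
    then have "?B I \<subseteq> ?B H" by (auto simp: standard_monomials_def)
    moreover have "card (?B I) = card (?B H)"
      using card_eq hilbert_function_eq_card[OF H(1) basis(1)] hilbert_function_eq_card[OF I(1) basis(2)]
      by simp
    ultimately have B_eq: "?B I = ?B H"
      by (intro card_subset_eq) (auto simp: finite_standard_monomials)
    obtain c where c: "p - (\<Sum>b\<in>?B H. Const (c b) * b) \<in> H"
      using basis(1) p(2) unfolding graded_quotient_basis_def by blast
    then have "p - (\<Sum>b\<in>?B I. Const (c b) * b) \<in> I"
      unfolding B_eq using sub by blast
    from ideal.subspace_diff[OF I(1) p(1) this] have "(\<Sum>b\<in>?B I. Const (c b) * b) \<in> I"
      by simp
    then have "\<forall>b\<in>?B I. c b = 0"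
      using basis(2) unfolding graded_quotient_basis_def by blast
    then have "(\<Sum>b\<in>?B H. Const (c b) * b) = 0"
      unfolding B_eq by (intro sum.neutral) (auto simp: Const_0)
    then show "p \<in> H" using c by simp
  qed
qed

lemma hilbert_polynomial_cong:
  assumes eq: "\<forall>\<^sub>F d in sequentially. \<forall>p. homogeneous d p \<longrightarrow> (p \<in> J \<longleftrightarrow> p \<in> L)"
  shows "hilbert_polynomial J = hilbert_polynomial L"
proof -
  have "\<forall>\<^sub>F d in sequentially. hilbert_function J d = hilbert_function L d"
    using eq
  proof eventually_elim
    case (elim d)
    have "graded_quotient_basis J d B = graded_quotient_basis L d B" for B
    proof (cases "B \<subseteq> {p. homogeneous d p}")
      case True
      then have hom: "homogeneous d (\<Sum>b\<in>B. Const (c b) * b)" for c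
        by (intro homogeneous_sum homogeneous_Const_mult) auto
      have independent_iff: "(\<Sum>b\<in>B. Const (c b) * b) \<in> J \<longleftrightarrow> (\<Sum>b\<in>B. Const (c b) * b) \<in> L" for c
        using elim hom by blast
      have "p - (\<Sum>b\<in>B. Const (c b) * b) \<in> J \<longleftrightarrow> p - (\<Sum>b\<in>B. Const (c b) * b) \<in> L"
        if "homogeneous d p" for p c
        using elim homogeneous_diff[OF that hom] by blast
      then have spanning_iff:
        "(\<forall>p. homogeneous d p \<longrightarrow> (\<exists>c. p - (\<Sum>b\<in>B. Const (c b) * b) \<in> J))
         \<longleftrightarrow> (\<forall>p. homogeneous d p \<longrightarrow> (\<exists>c. p - (\<Sum>b\<in>B. Const (c b) * b) \<in> L))"
        by meson
      show ?thesis
        unfolding graded_quotient_basis_def independent_iff spanning_iff ..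
    next
      case False
      then show ?thesis by (simp add: graded_quotient_basis_def)
    qed
    then show ?case by (simp add: hilbert_function_def)
  qed
  then have "(\<forall>\<^sub>F d in sequentially. of_nat (hilbert_function J d) = poly P (of_nat d))
      \<longleftrightarrow> (\<forall>\<^sub>F d in sequentially. of_nat (hilbert_function L d) = poly P (of_nat d))" for P :: "rat poly"
    by (intro eventually_subst) (auto elim: eventually_mono)
  then show ?thesis by (simp add: hilbert_polynomial_def)
qed

section \<open>Irreducible ideals and a regular linear form\<close>

definition irreducible_ideal :: "'a::comm_ring_1 set \<Rightarrow> bool" where
  "irreducible_ideal Q \<longleftrightarrow> ideal.subspace Q \<and>
     (\<forall>A B. ideal.subspace A \<longrightarrow> ideal.subspace B \<longrightarrow> A \<inter> B = Q \<longrightarrow> A = Q \<or> B = Q)"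

text \<open>
  Noetherian induction: an ideal that is not irreducible is the intersection of two larger ones.
\<close>

lemma irreducible_decomposition:
  assumes noeth: "noetherian TYPE('a::comm_ring_1)" and "ideal.subspace (J :: 'a set)"
  obtains F where "finite F" "\<And>Q. Q \<in> F \<Longrightarrow> irreducible_ideal Q" "J = \<Inter>F"
proof -
  have "\<exists>F. finite F \<and> (\<forall>Q\<in>F. irreducible_ideal Q) \<and> J = \<Inter>F"
    using assms(2)
  proof (induction J rule: wf_induct_rule[OF noeth[unfolded noetherian_def]])
    case (1 J)
    show ?case
    proof (cases "irreducible_ideal J")
      case True
      then show ?thesis by (intro exI[of _ "{J}"]) simp
    next
      case False
      then obtain A B where AB: "ideal.subspace A" "ideal.subspace B" "A \<inter> B = J" "A \<noteq> J" "B \<noteq> J"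
        using "1.prems" by (auto simp: irreducible_ideal_def)
      then have "J \<subset> A" "J \<subset> B" by auto
      then obtain F G where "finite F" "\<forall>Q\<in>F. irreducible_ideal Q" "A = \<Inter>F"
          "finite G" "\<forall>Q\<in>G. irreducible_ideal Q" "B = \<Inter>G"
        using "1.IH"[of A] "1.IH"[of B] AB "1.prems" by auto
      then show ?thesis
        using AB(3) by (intro exI[of _ "F \<union> G"]) auto
    qed
  qed
  then show ?thesis using that by blast
qed

text \<open>
  The ideals \<open>Q + (a)\<close> and \<open>Q + (b)\<close> are larger than \<open>Q\<close>, so is their intersection; \<open>p\<close> is
  one of its new elements.
\<close>

lemma irreducible_idealD:
  assumes Q: "irreducible_ideal Q" and "a \<notin> Q" "b \<notin> Q"
  obtains p s t where "p \<notin> Q" "p - s * a \<in> Q" "p - t * b \<in> Q"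
proof -
  have sub: "ideal.subspace Q" using Q by (simp add: irreducible_ideal_def)
  then have span_Q: "ideal.span Q = Q" by (simp add: ideal.span_eq_iff)
  have "a \<in> ideal.span (insert a Q)" "b \<in> ideal.span (insert b Q)" by (auto intro: ideal.span_base)
  then have "ideal.span (insert a Q) \<noteq> Q" "ideal.span (insert b Q) \<noteq> Q" using assms(2,3) by auto
  then have "ideal.span (insert a Q) \<inter> ideal.span (insert b Q) \<noteq> Q"
    using Q unfolding irreducible_ideal_def by (metis ideal.subspace_span)
  moreover have "Q \<subseteq> ideal.span (insert a Q) \<inter> ideal.span (insert b Q)"
    by (auto intro: ideal.span_base)
  ultimately obtain p where "p \<notin> Q" "p \<in> ideal.span (insert a Q)" "p \<in> ideal.span (insert b Q)"
    by blast
  then show ?thesis using that by (auto simp: ideal.span_breakdown_eq span_Q)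
qed

definition zero_divisors_mod :: "'a::comm_ring_1 set \<Rightarrow> 'a set" where
  "zero_divisors_mod Q = {z. \<exists>p. p \<notin> Q \<and> z * p \<in> Q}"

lemma zero_divisors_mod_scale:
  assumes "ideal.subspace Q" "z \<in> zero_divisors_mod Q"
  shows "c * z \<in> zero_divisors_mod Q"
  using assms ideal.subspace_scale[OF assms(1), of _ c] by (auto simp: zero_divisors_mod_def mult.assoc)

text \<open>
  If \<open>x\<close> kills \<open>a\<close> and \<open>y\<close> kills \<open>b\<close> modulo \<open>Q\<close>, then both kill a common multiple of \<open>a\<close> and
  \<open>b\<close> modulo \<open>Q\<close>, and by irreducibility there is one outside \<open>Q\<close>.
\<close>

lemma zero_divisors_mod_add:
  assumes Q: "irreducible_ideal Q" and "x \<in> zero_divisors_mod Q" "y \<in> zero_divisors_mod Q"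
  shows "x + y \<in> zero_divisors_mod Q"
proof -
  have sub: "ideal.subspace Q" using Q by (simp add: irreducible_ideal_def)
  obtain a b where a: "a \<notin> Q" "x * a \<in> Q" and b: "b \<notin> Q" "y * b \<in> Q"
    using assms(2,3) by (auto simp: zero_divisors_mod_def)
  obtain p s t where p: "p \<notin> Q" "p - s * a \<in> Q" "p - t * b \<in> Q"
    by (rule irreducible_idealD[OF Q a(1) b(1)])
  have "(x + y) * p = x * (p - s * a) + s * (x * a) + y * (p - t * b) + t * (y * b)"
    by (simp add: algebra_simps)
  also have "\<dots> \<in> Q"
    by (intro ideal.subspace_add[OF sub] ideal.subspace_scale[OF sub] a b p)
  finally show ?thesis using p(1) by (auto simp: zero_divisors_mod_def)
qed

text \<open>
  Irreducible ideals of a Noetherian ring are primary. The chain of the ideals \<open>C n = Q : z\<^sup>n\<close> has a step with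
  \<open>C (n + 1) = C n\<close>. Suppose that \<open>z * a \<in> Q\<close>. If \<open>p\<close> is congruent modulo \<open>Q\<close> to a multiple of \<open>a\<close> and
  to a multiple \<open>t * z\<^sup>n\<close>, then \<open>z * p \<in> Q\<close>, hence \<open>t \<in> C (n + 1) = C n\<close> and \<open>p \<in> Q\<close>. So \<open>a\<close> and
  \<open>z\<^sup>n\<close> cannot both be outside the irreducible ideal \<open>Q\<close>.
\<close>

lemma zero_divisor_mod_irreducible_nilpotent:
  assumes noeth: "noetherian TYPE('a::comm_ring_1)" and Q: "irreducible_ideal (Q :: 'a set)"
    and z: "z \<in> zero_divisors_mod Q"
  obtains k where "z ^ k \<in> Q"
proof -
  have sub: "ideal.subspace Q" using Q by (simp add: irreducible_ideal_def)
  obtain a where a: "a \<notin> Q" "z * a \<in> Q"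
    using z by (auto simp: zero_divisors_mod_def)
  define C where "C n = {x. z ^ n * x \<in> Q}" for n
  have ideal_C: "ideal.subspace (C n)" for n
    using sub by (auto simp: ideal.subspace_def C_def distrib_left mult.left_commute)
  have C_mono: "C n \<subseteq> C (Suc n)" for n
    using ideal.subspace_scale[OF sub, of _ z] by (auto simp: C_def mult.assoc)
  obtain n where n: "C (Suc n) = C n"
  proof (rule ccontr)
    assume "\<not> thesis"
    then have "C n \<subset> C (Suc n)" for n using C_mono[of n] that by blast
    then have "\<forall>n. (C (Suc n), C n) \<in> {(L, J). ideal.subspace J \<and> ideal.subspace L \<and> J \<subset> L}"
      using ideal_C by (simp add: case_prod_beta)
    then show False
      using noeth unfolding noetherian_def wf_iff_no_infinite_down_chain by blast
  qed
  have "z ^ n \<in> Q"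
  proof (rule ccontr)
    assume "z ^ n \<notin> Q"
    then obtain p s t where p: "p \<notin> Q" "p - s * a \<in> Q" "p - t * z ^ n \<in> Q"
      using irreducible_idealD[OF Q a(1)] by metis
    have "z ^ Suc n * t = z * (p - s * a) + s * (z * a) - z * (p - t * z ^ n)"
      by (simp add: algebra_simps)
    also have "\<dots> \<in> Q"
      by (intro ideal.subspace_add[OF sub] ideal.subspace_diff[OF sub] ideal.subspace_scale[OF sub] a p)
    finally have "t \<in> C n" using n by (auto simp: C_def)
    then have "(p - t * z ^ n) + z ^ n * t \<in> Q"
      by (intro ideal.subspace_add[OF sub] p) (simp add: C_def)
    then show False using p(1) by (simp add: mult.commute)
  qed
  then show ?thesis by (rule that)
qed

text \<open>
  Otherwise \<open>1\<close> plus the product of all \<open>X - a\<close> would be a nonconstant polynomial without a root.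
\<close>

lemma infinite_UNIV_alg_closed_field: "infinite (UNIV :: 'k::alg_closed_field set)"
proof
  assume fin: "finite (UNIV :: 'k set)"
  let ?q = "\<Prod>a\<in>(UNIV :: 'k set). [:- a, 1:]"
  have "degree ?q = card (UNIV :: 'k set)"
    using degree_prod_eq_sum_degree[of "UNIV :: 'k set" "\<lambda>a. [:- a, 1:]"] by simp
  then have "degree (?q + 1) > 0"
    using fin by (simp add: degree_add_eq_left finite_UNIV_card_ge_0)
  then obtain x where "poly (?q + 1) x = 0"
    using alg_closed_imp_poly_has_root by blast
  moreover have "poly ?q x = 0"
    using fin by (simp add: poly_prod prod_zero_iff)
  ultimately show False by simp
qed

text \<open>
  A vector space over an infinite field is not a finite union of proper subspaces. Let \<open>w\<close> avoid all
  members of \<open>F\<close> but lie in \<open>Z\<close>, and let \<open>u\<close> avoid \<open>Z\<close>. The line \<open>u + c w\<close> misses \<open>Z\<close>, and it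
  meets each member of \<open>F\<close> in at most one point, so almost all its points avoid everything. The
  members of \<open>F\<close> may be empty, as are the zero divisors modulo the unit ideal.
\<close>

lemma linear_form_avoiding:
  fixes F :: "('v::finite, 'k::field) mpoly set set"
  assumes inf: "infinite (UNIV :: 'k set)" and "finite F"
    and "\<And>Y a b. Y \<in> F \<Longrightarrow> a \<in> Y \<Longrightarrow> b \<in> Y \<Longrightarrow> a + b \<in> Y"
    and "\<And>Y a c. Y \<in> F \<Longrightarrow> a \<in> Y \<Longrightarrow> c * a \<in> Y"
    and "\<And>Y. Y \<in> F \<Longrightarrow> \<exists>z. linear_form z \<and> z \<notin> Y"
  shows "\<exists>z. linear_form z \<and> z \<notin> \<Union>F"
  using assms(2-)
proof (induction F)
  case empty
  show ?case using homogeneous_0 by auto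
next
  case (insert Z F)
  note add = insert.prems(1) and scale = insert.prems(2)
  obtain w where w: "linear_form w" "w \<notin> \<Union>F"
    using insert.IH[OF add scale insert.prems(3)] by blast
  show ?case
  proof (cases "w \<in> Z")
    case False
    then show ?thesis using w by auto
  next
    case True
    obtain u where u: "linear_form u" "u \<notin> Z" using insert.prems(3)[of Z] by auto
    have "finite {c. u + Const c * w \<in> Y}" if Y: "Y \<in> F" for Y
    proof (rule ccontr)
      assume "infinite {c. u + Const c * w \<in> Y}"
      then obtain c d where cd: "u + Const c * w \<in> Y" "u + Const d * w \<in> Y" "c \<noteq> d"
        by (metis (mono_tags) finite.emptyI finite_insert finite_subset insertI1 mem_Collect_eq subsetI)
      have "(u + Const c * w) + (- 1) * (u + Const d * w) \<in> Y"
        using Y by (intro add[OF _ cd(1) scale[OF _ cd(2)]]) auto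
      then have "Const (c - d) * w \<in> Y"
        by (simp add: Const_add[of c "- d", simplified] Const_uminus algebra_simps)
      then have "Const (inverse (c - d)) * (Const (c - d) * w) \<in> Y"
        by (rule scale[rotated]) (use Y in simp)
      moreover have "Const (inverse (c - d)) * (Const (c - d) * w) = w"
        using cd(3) by (simp add: Const_1 flip: mult.assoc Const_mult)
      ultimately show False using w(2) Y by auto
    qed
    then have "finite (\<Union>Y\<in>F. {c. u + Const c * w \<in> Y})" using insert.hyps(1) by blast
    then obtain c where c: "c \<notin> (\<Union>Y\<in>F. {c. u + Const c * w \<in> Y})"
      using ex_new_if_finite[OF inf] by blast
    have "u + Const c * w \<notin> Z"
    proof
      assume "u + Const c * w \<in> Z"
      then have "(u + Const c * w) + (- Const c) * w \<in> Z"
        by (rule add[OF insertI1 _ scale[OF insertI1 True]])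
      then show False using u(2) by simp
    qed
    moreover have "linear_form (u + Const c * w)"
      by (intro homogeneous_add homogeneous_Const_mult u w)
    ultimately show ?thesis using c by blast
  qed
qed

text \<open>
  In an irreducible decomposition of \<open>J\<close>, let \<open>G\<close> collect the components modulo which some
  variable is regular. The other components contain a power of each variable; since \<open>J\<close> is
  saturated, it is already the intersection of \<open>G\<close>. A linear form that is regular modulo every component
  in \<open>G\<close> is then regular modulo \<open>J\<close>.
\<close>

lemma regular_linear_form_exists:
  fixes J :: "('v::finite, 'k::field) mpoly set"
  assumes inf: "infinite (UNIV :: 'k set)"
    and noeth: "noetherian TYPE(('v, 'k) mpoly)"
    and J: "ideal.subspace J" "J \<noteq> UNIV"
    and sat: "\<And>p. (\<And>v. \<exists>k. Var v ^ k * p \<in> J) \<Longrightarrow> p \<in> J"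
  obtains z where "linear_form z" "z \<noteq> 0" "regular_mod z J"
proof -
  obtain F where F: "finite F" "\<And>Q. Q \<in> F \<Longrightarrow> irreducible_ideal Q" "J = \<Inter>F"
    by (rule irreducible_decomposition[OF noeth J(1)]) blast
  have sub: "ideal.subspace Q" if "Q \<in> F" for Q
    using F(2)[OF that] by (simp add: irreducible_ideal_def)
  define G where "G = {Q \<in> F. \<exists>v. Var v \<notin> zero_divisors_mod Q}"
  have J_eq: "J = \<Inter>G"
  proof
    show "J \<subseteq> \<Inter>G" using F(3) by (auto simp: G_def)
    have "p \<in> J" if p: "p \<in> \<Inter>G" for p
    proof (rule sat)
      fix v
      have "\<exists>k. Var v ^ k \<in> Q" if "Q \<in> F - G" for Q
      proof -
        have "Q \<in> F" "Var v \<in> zero_divisors_mod Q" using that by (auto simp: G_def)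
        then show ?thesis using zero_divisor_mod_irreducible_nilpotent[OF noeth F(2)] by metis
      qed
      then obtain k where k: "\<And>Q. Q \<in> F - G \<Longrightarrow> Var v ^ k Q \<in> Q" by metis
      define K where "K = Max (insert 0 (k ` F))"
      have "Var v ^ K * p \<in> Q" if "Q \<in> F" for Q
      proof (cases "Q \<in> G")
        case True
        then show ?thesis using p by (auto intro: ideal.subspace_scale sub that)
      next
        case False
        have "k Q \<le> K" unfolding K_def using F(1) that by (intro Max_ge) auto
        then have "Var v ^ K * p = (Var v ^ (K - k Q) * p) * Var v ^ k Q"
          by (simp add: mult.assoc mult.left_commute flip: power_add)
        also have "\<dots> \<in> Q" using k that False by (intro ideal.subspace_scale sub) auto
        finally show ?thesis .
      qed
      then show "\<exists>k. Var v ^ k * p \<in> J" using F(3) by blast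
    qed
    then show "\<Inter>G \<subseteq> J" by blast
  qed
  have "\<exists>z. linear_form z \<and> z \<notin> \<Union>(zero_divisors_mod ` G)"
  proof (rule linear_form_avoiding[OF inf])
    show "finite (zero_divisors_mod ` G)" using F(1) by (simp add: G_def)
  next
    fix Y assume "Y \<in> zero_divisors_mod ` G"
    then obtain Q where Q: "Q \<in> G" "Y = zero_divisors_mod Q" by blast
    then have "Q \<in> F" by (simp add: G_def)
    show "a + b \<in> Y" if "a \<in> Y" "b \<in> Y" for a b
      using zero_divisors_mod_add[OF F(2)[OF \<open>Q \<in> F\<close>]] that Q(2) by simp
    show "c * a \<in> Y" if "a \<in> Y" for a c
      using zero_divisors_mod_scale[OF sub[OF \<open>Q \<in> F\<close>]] that Q(2) by simp
    show "\<exists>z. linear_form z \<and> z \<notin> Y"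
      using Q homogeneous_Var by (auto simp: G_def)
  qed
  then obtain z where z: "linear_form z" "\<And>Q. Q \<in> G \<Longrightarrow> z \<notin> zero_divisors_mod Q" by auto
  \<comment> \<open>Modulo a proper ideal \<open>0\<close> is a zero divisor, so \<open>z\<close> is not \<open>0\<close>.\<close>
  obtain Q where Q: "Q \<in> G" "Q \<noteq> UNIV" using J(2) J_eq by auto
  then have "ideal.subspace Q" by (simp add: G_def sub)
  then have "0 \<in> zero_divisors_mod Q"
    using Q(2) ideal.subspace_0 by (auto simp: zero_divisors_mod_def)
  then have "z \<noteq> 0" using z(2)[OF Q(1)] by auto
  moreover have "regular_mod z J"
    using z(2) J_eq by (auto simp: regular_mod_def zero_divisors_mod_def)
  ultimately show ?thesis using z(1) that by blast
qed

section \<open>The equivalences\<close>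

lemma homogeneous_ideal_span_insert_form:
  assumes "homogeneous_ideal H" "is_form f"
  shows "homogeneous_ideal (ideal.span (H \<union> {f}))"
proof -
  obtain F where F: "\<forall>p\<in>F. is_form p" "H = ideal.span F"
    using assms(1) by (auto simp: homogeneous_ideal_def)
  have "ideal.span (H \<union> {f}) = ideal.span (F \<union> {f})"
  proof (rule ideal.span_eq[THEN iffD2], intro conjI)
    have "H \<subseteq> ideal.span (F \<union> {f})"
      unfolding F(2) by (rule ideal.span_mono) auto
    then show "H \<union> {f} \<subseteq> ideal.span (F \<union> {f})"
      by (auto intro: ideal.span_base)
    show "F \<union> {f} \<subseteq> ideal.span (H \<union> {f})"
      unfolding F(2) by (auto intro: ideal.span_base)
  qed
  then show ?thesis
    using F(1) assms(2) unfolding homogeneous_ideal_def by (intro exI[of _ "F \<union> {f}"]) auto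
qed

text \<open>
  A form of large degree \<open>d\<close> in the ideal generated by \<open>H\<close> and \<open>f\<close> can be written as \<open>h + a f\<close> with
  \<open>h \<in> H\<close>, where \<open>a\<close> is a form of degree \<open>d - deg f\<close>. All monomials of \<open>a\<close> have large degree, so
  \<open>a f\<close> lies in \<open>H\<close>.
\<close>

lemma eventually_eq_if_mem_saturation:
  fixes H :: "('v::finite, 'k::comm_ring_1) mpoly set"
  assumes H: "ideal.subspace H" "homogeneous_ideal H" and f: "is_form f" "f \<in> saturation H"
  shows "\<forall>\<^sub>F d in sequentially. \<forall>p. homogeneous d p \<longrightarrow> (p \<in> ideal.span (H \<union> {f}) \<longleftrightarrow> p \<in> H)"
proof -
  obtain e where e: "homogeneous e f" using f(1) by (auto simp: is_form_def)
  obtain t where t: "\<And>p. (\<And>m. m \<in> keys p \<Longrightarrow> t \<le> mon_degree m) \<Longrightarrow> f * p \<in> H"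
    using mult_mem_if_Var_power_mult_mem[OF H(1), of f] f(2) saturation_iff[OF H(1)] by metis
  have "p \<in> H" if d: "t + e \<le> d" and p: "homogeneous d p" "p \<in> ideal.span (H \<union> {f})" for d p
  proof -
    have "p \<in> ideal.span (insert f H)" using p(2) by simp
    then obtain a where "p - a * f \<in> ideal.span H"
      by (auto simp: ideal.span_breakdown_eq)
    then have "p - a * f \<in> H"
      using H(1) by (metis ideal.span_eq_iff)
    then have "hcomp d (p - a * f) \<in> H"
      by (rule homogeneous_ideal_hcomp[OF H(2)])
    then have "p - hcomp (d - e) a * f \<in> H"
      using d by (simp add: hcomp_diff hcomp_homogeneous[OF p(1)] hcomp_mult_homogeneous[OF e])
    moreover have "f * hcomp (d - e) a \<in> H"
      using d by (intro t) (auto simp: keys_hcomp)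
    ultimately have "p - hcomp (d - e) a * f + f * hcomp (d - e) a \<in> H"
      by (rule ideal.subspace_add[OF H(1)])
    then show ?thesis by (simp add: mult.commute)
  qed
  then show ?thesis
    unfolding eventually_sequentially by (intro exI[of _ "t + e"]) (auto intro: ideal.span_base)
qed

lemma mem_saturation_if_eventually_eq:
  fixes H :: "('v::finite, 'k::comm_ring_1) mpoly set"
  assumes H: "ideal.subspace H" and I: "ideal.subspace I" and f: "is_form f" "f \<in> I"
    and eq: "\<forall>\<^sub>F d in sequentially. \<forall>p\<in>I. homogeneous d p \<longrightarrow> p \<in> H"
  shows "f \<in> saturation H"
  unfolding saturation_iff[OF H]
proof
  fix v
  obtain e where e: "homogeneous e f" using f(1) by (auto simp: is_form_def)
  obtain N where N: "\<And>d p. N \<le> d \<Longrightarrow> p \<in> I \<Longrightarrow> homogeneous d p \<Longrightarrow> p \<in> H"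
    using eq unfolding eventually_sequentially by blast
  have "homogeneous (N * 1 + e) (Var v ^ N * f)"
    by (intro homogeneous_mult homogeneous_power homogeneous_Var e)
  then have "Var v ^ N * f \<in> H"
    by (intro N[of "N * 1 + e"] ideal.subspace_scale[OF I] f) auto
  then show "\<exists>k. Var v ^ k * f \<in> H" by blast
qed

theorem proposition3p1:
  fixes v0 :: "'v::finite"
    and r :: nat
    and g :: "nat \<Rightarrow> ('v, 'k::alg_closed_field) mpoly"
    and f :: "('v, 'k) mpoly"
    and H I :: "('v, 'k) mpoly set"
  assumes "H = ideal.span (g ` {1..r})"
    and "homogeneous_ideal H"
    and "saturation H \<subset> irrelevant_ideal"
    and "is_form f" and "f \<in> irrelevant_ideal"
    and "I = ideal.span (H \<union> {f})"
  shows
    "let i = (\<exists>t::nat. (\<lambda>p. f * p) ` ideal_power irrelevant_ideal t \<subseteq> H);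
         ii = (hilbert_polynomial I = hilbert_polynomial H);
         iii = (\<exists>z A. linear_form z \<and> z \<noteq> 0 \<and> regular_mod z (saturation H) \<and>
                  adapted_coords v0 z A \<and> dehom v0 A ` H = dehom v0 A ` I);
         iv = (\<forall>z A. linear_form z \<and> z \<noteq> 0 \<and> z \<in> irrelevant_ideal \<and>
                  adapted_coords v0 z A \<longrightarrow> dehom v0 A ` H = dehom v0 A ` I)
     in (i \<longleftrightarrow> ii) \<and> (ii \<longleftrightarrow> iii) \<and> (iii \<longleftrightarrow> iv)"
proof -
  have H: "ideal.subspace H" "homogeneous_ideal H" using assms(1,2) by auto
  have I: "ideal.subspace I" "homogeneous_ideal I"
    using assms(4,6) homogeneous_ideal_span_insert_form[OF H(2)] by auto
  have HI: "H \<subseteq> I" "f \<in> I" using assms(6) by (auto intro: ideal.span_base)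
  have i_iff: "(\<exists>t. (\<lambda>p. f * p) ` ideal_power irrelevant_ideal t \<subseteq> H) \<longleftrightarrow> f \<in> saturation H"
    by (simp add: saturation_def)
  have ii_iff: "hilbert_polynomial I = hilbert_polynomial H \<longleftrightarrow> f \<in> saturation H"
  proof
    assume "hilbert_polynomial I = hilbert_polynomial H"
    then show "f \<in> saturation H"
      by (intro mem_saturation_if_eventually_eq[OF H(1) I(1) assms(4) HI(2)]
          hilbert_polynomial_eq_imp_eventually_eq H I HI)
  next
    assume "f \<in> saturation H"
    then show "hilbert_polynomial I = hilbert_polynomial H"
      unfolding assms(6) by (intro hilbert_polynomial_cong eventually_eq_if_mem_saturation H assms(4))
  qed
  have dehom_eq: "dehom v0 A ` H = dehom v0 A ` I"
    if f: "f \<in> saturation H" and z: "linear_form z" "adapted_coords v0 z A" for z A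
  proof -
    obtain t where t: "\<And>p. p \<in> ideal_power irrelevant_ideal t \<Longrightarrow> f * p \<in> H"
      using f by (auto simp: saturation_def)
    have "z ^ t \<in> ideal_power irrelevant_ideal t"
      by (intro power_mem_ideal_power linear_form_mem_irrelevant_ideal z(1))
    from t[OF this] have "z ^ t * f \<in> H" by (simp add: mult.commute)
    then show ?thesis
      unfolding assms(6) by (rule dehom_image_eq_if_power_mult_mem[OF H(1) z(2)])
  qed
  have power_mult_mem: "\<exists>k. z ^ k * f \<in> H"
    if "linear_form z" "adapted_coords v0 z A" "dehom v0 A ` H = dehom v0 A ` I" for z A
  proof -
    obtain e where "homogeneous e f" using assms(4) by (auto simp: is_form_def)
    moreover have "dehom v0 A f \<in> dehom v0 A ` H" unfolding that(3) using HI(2) by (rule imageI)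
    ultimately show ?thesis
      using dehom_mem_imp_power_mult_mem[OF H that(1,2)] by metis
  qed
  have iii_iff: "(\<exists>z A. linear_form z \<and> z \<noteq> 0 \<and> regular_mod z (saturation H) \<and>
      adapted_coords v0 z A \<and> dehom v0 A ` H = dehom v0 A ` I) \<longleftrightarrow> f \<in> saturation H"
  proof
    assume "\<exists>z A. linear_form z \<and> z \<noteq> 0 \<and> regular_mod z (saturation H) \<and>
      adapted_coords v0 z A \<and> dehom v0 A ` H = dehom v0 A ` I"
    then obtain z A where z: "linear_form z" "adapted_coords v0 z A" "regular_mod z (saturation H)"
      and eq: "dehom v0 A ` H = dehom v0 A ` I"
      by blast
    from power_mult_mem[OF z(1,2) eq] obtain k where k: "z ^ k * f \<in> H" ..
    have "z ^ k * f \<in> saturation H"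
      unfolding saturation_iff[OF H(1)] using ideal.subspace_scale[OF H(1) k] by simp
    then show "f \<in> saturation H"
      using z(3) by (induction k) (auto simp: regular_mod_def mult.assoc)
  next
    assume f: "f \<in> saturation H"
    have "saturation H \<noteq> UNIV" using assms(3) by auto
    then obtain z where z: "linear_form z" "z \<noteq> 0" "regular_mod z (saturation H)"
      using regular_linear_form_exists[OF infinite_UNIV_alg_closed_field noetherian_mpoly
          subspace_saturation[OF H(1)] _ saturation_saturated[OF H(1)]]
      by metis
    obtain A where A: "adapted_coords v0 z A" by (rule adapted_coords_exist[OF z(1,2)])
    show "\<exists>z A. linear_form z \<and> z \<noteq> 0 \<and> regular_mod z (saturation H) \<and>
      adapted_coords v0 z A \<and> dehom v0 A ` H = dehom v0 A ` I"
      using z A dehom_eq[OF f z(1) A] by blast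
  qed
  have iv_iff: "(\<forall>z A. linear_form z \<and> z \<noteq> 0 \<and> z \<in> irrelevant_ideal \<and>
      adapted_coords v0 z A \<longrightarrow> dehom v0 A ` H = dehom v0 A ` I) \<longleftrightarrow> f \<in> saturation H"
  proof
    assume iv: "\<forall>z A. linear_form z \<and> z \<noteq> 0 \<and> z \<in> irrelevant_ideal \<and>
      adapted_coords v0 z A \<longrightarrow> dehom v0 A ` H = dehom v0 A ` I"
    show "f \<in> saturation H"
      unfolding saturation_iff[OF H(1)]
    proof
      fix v
      have Var: "linear_form (Var v :: ('v, 'k) mpoly)" "Var v \<noteq> (0 :: ('v, 'k) mpoly)"
        using homogeneous_Var by (blast, metis Var_def lookup_single_eq lookup_zero zero_neq_one)
      then obtain A where A: "adapted_coords v0 (Var v :: ('v, 'k) mpoly) A"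
        by (rule adapted_coords_exist)
      then show "\<exists>k. Var v ^ k * f \<in> H"
        using iv Var linear_form_mem_irrelevant_ideal[OF Var(1)] by (intro power_mult_mem[OF Var(1) A]) blast
    qed
  next
    assume f: "f \<in> saturation H"
    show "\<forall>z A. linear_form z \<and> z \<noteq> 0 \<and> z \<in> irrelevant_ideal \<and>
      adapted_coords v0 z A \<longrightarrow> dehom v0 A ` H = dehom v0 A ` I"
      using dehom_eq[OF f] by blast
  qed
  show ?thesis
    unfolding Let_def i_iff ii_iff iii_iff iv_iff by simp
qed

end
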